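(* Let $n(2)=3$, $n(3)=4$, $n(4)=6$, $n(5)=12$. Let $N\in\{2,3,4,5\}$ and let $f_N:\mathbb{H}\to\mathbb{CP}^1\setminus\{a_1=0,a_2,\ldots,a_{n(N)}\}$ be a universal covering with deck transformation group $\operatorname{Aut}(f_N)=\Gamma(N)$ which vanishes at infinity. Let $A,B$ be the first two coefficients of its expansion $f_N(\tau)=Aq_N+Bq_N^2+\cdots$ in $q_N=\exp\{\frac{2\pi}{N}i\tau\}$. Then the complete Kähler-Einstein metric on $\mathbb{CP}^1\setminus\{a_1=0,a_2,\ldots,a_{n(N)}\}$ has the asymptotic expansion $$|ds|=\frac{1}{|f|\,\bigl|\log|\frac{f}{A}|\bigr|}\left|1-\left(\frac{B}{A}\frac{f}{A}-\frac{\operatorname{Re}\left(\frac{B}{A}\frac{f}{A}\right)}{\log|\frac{f}{A}|}\right)+\sum_{m=2}^{\infty}R_m\!\left(\frac{B}{A},\frac{f}{A},\frac{f^s\,\overline{f^{m-s}}}{A^s\,\overline{A^{m-s}}\,\log^j|\frac{f}{A}|}\right)\right||df|$$ at the cusp $a_1=0$, where $f$ denotes the coordinate of a point of $\mathbb{CP}^1\setminus\{a_1=0,a_2,\ldots,a_{n(N)}\}$, and for every $m\ge2$, $R_m$ is a polynomial in $\frac{B}{A}$, $\frac{f}{A}$ and the quantities $\frac{f^s\overline{f^{m-s}}}{A^s\overline{A^{m-s}}\log^j|\frac{f}{A}|}$, $s,j=0,1,\ldots,m$, with constant coefficients.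
   Context: $\mathbb{H}$ is the upper half plane. $\operatorname{Aut}(f)$ denotes the deck transformation group of a universal covering $f$ from $\mathbb{H}$. The principal congruence subgroup of level $N$ is $$\Gamma(N)=\left\{\begin{pmatrix}a&b\\c&d\end{pmatrix}\in\mathrm{SL}_2(\mathbb{Z})\;:\;\begin{pmatrix}a&b\\c&d\end{pmatrix}\equiv\pm\begin{pmatrix}1&0\\0&1\end{pmatrix}\pmod N\right\}\Big/\pm I.$$ "$f_N$ vanishes at infinity" means $f_N(\infty)=0$, i.e. $f_N(\tau)\to0$ as $\operatorname{Im}\tau\to\infty$. The complete Kähler-Einstein metric on the punctured sphere is the one induced through the covering map from the Poincaré metric $ds^2=\frac{-4}{(\tau-\bar\tau)^2}|d\tau|^2=\frac{|d\tau|^2}{(\operatorname{Im}\tau)^2}$ on $\mathbb{H}$.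
   Formalization: The polynomials R_m may also involve the complex conjugate of B/A; with constant coefficients independent of f_N the claim is false without it, since the |f/A|^2/log^2|f/A| term of R_2 must have real part |B/A|^2/2. *)

theory Defs
  imports "HOL-Complex_Analysis.Complex_Analysis" "HOL-Library.Poly_Mapping"
    "HOL-Number_Theory.Cong"
begin

section \<open>The complex projective line\<close>

text \<open>\<open>\<complex>\<P>\<^sup>1\<close> is the one-point compactification of the complex plane, with the two standard
  affine charts \<open>z\<close> and \<open>1/z\<close>. Off its chart domain, a chart takes an irrelevant default value.\<close>

datatype cp1 = Aff complex | Infty

fun aff :: "cp1 \<Rightarrow> complex" where
  "aff (Aff z) = z"
| "aff Infty = 0"

fun aff_inf :: "cp1 \<Rightarrow> complex" where
  "aff_inf (Aff z) = 1 / z"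
| "aff_inf Infty = 0"

instantiation cp1 :: topological_space
begin

definition open_cp1 :: "cp1 set \<Rightarrow> bool" where
  "open_cp1 U \<longleftrightarrow>
     open (Aff -` U) \<and> (Infty \<in> U \<longrightarrow> (\<forall>\<^sub>F z in at_infinity. Aff z \<in> U))"

instance
proof
  show "open (UNIV :: cp1 set)"
    by (simp add: open_cp1_def)
next
  fix S T :: "cp1 set"
  assume "open S" "open T"
  then show "open (S \<inter> T)"
    by (auto simp: open_cp1_def eventually_conj_iff)
next
  fix K :: "cp1 set set"
  assume *: "\<forall>S\<in>K. open S"
  have "open (\<Union>S\<in>K. Aff -` S)"
    using * by (intro open_UN) (auto simp: open_cp1_def)
  moreover have "\<forall>\<^sub>F z in at_infinity. Aff z \<in> \<Union>K" if S: "S \<in> K" "Infty \<in> S" for S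
  proof -
    have "\<forall>\<^sub>F z in at_infinity. Aff z \<in> S"
      using * S by (auto simp: open_cp1_def)
    then show ?thesis
      by (rule eventually_mono) (use S in auto)
  qed
  ultimately show "open (\<Union>K)"
    by (auto simp: open_cp1_def vimage_Union)
qed

end

definition cp1_holomorphic_on :: "(complex \<Rightarrow> cp1) \<Rightarrow> complex set \<Rightarrow> bool" where
  "cp1_holomorphic_on f S \<longleftrightarrow> continuous_on S f \<and>
     (\<forall>\<tau>\<in>S. (f \<tau> \<noteq> Infty \<longrightarrow> (aff \<circ> f) analytic_on {\<tau>}) \<and>
            (f \<tau> \<noteq> Aff 0 \<longrightarrow> (aff_inf \<circ> f) analytic_on {\<tau>}))"


section \<open>Universal coverings from the upper half plane\<close>

definition upper_half_plane :: "complex set" where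
  "upper_half_plane = {\<tau>. Im \<tau> > 0}"

text \<open>Self-maps of the upper half plane are represented as functions that are
  \<^const>\<open>undefined\<close> outside it, so that sets of such maps can be compared by equality.\<close>

definition deck_group :: "(complex \<Rightarrow> cp1) \<Rightarrow> (complex \<Rightarrow> complex) set" where
  "deck_group f = {\<phi> \<in> extensional upper_half_plane.
     (\<exists>\<psi>. homeomorphism upper_half_plane upper_half_plane \<phi> \<psi>) \<and>
     (\<forall>\<tau>\<in>upper_half_plane. f (\<phi> \<tau>) = f \<tau>)}"

definition moebius :: "int^2^2 \<Rightarrow> complex \<Rightarrow> complex" where
  "moebius M \<tau> =
     (of_int (M$1$1) * \<tau> + of_int (M$1$2)) / (of_int (M$2$1) * \<tau> + of_int (M$2$2))"

definition congruence_matrices :: "nat \<Rightarrow> (int^2^2) set" where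
  "congruence_matrices N = {M. det M = 1 \<and>
     ((\<forall>i j. [M$i$j = mat 1$i$j] (mod int N)) \<or>
      (\<forall>i j. [M$i$j = - (mat 1$i$j)] (mod int N)))}"

text \<open>Two matrices in \<open>SL\<^sub>2(\<int>)\<close> act in the same way if and only if they agree up to sign, so passing
  to the transformations performs the quotient by \<open>\<plusminus>I\<close>.\<close>

definition principal_congruence_group :: "nat \<Rightarrow> (complex \<Rightarrow> complex) set" where
  "principal_congruence_group N =
     (\<lambda>M. restrict (moebius M) upper_half_plane) ` congruence_matrices N"

definition num_punctures :: "nat \<Rightarrow> nat" where
  "num_punctures N =
     (if N = 2 then 3 else if N = 3 then 4 else if N = 4 then 6 else if N = 5 then 12 else 0)"

definition vanishes_at_infinity :: "(complex \<Rightarrow> cp1) \<Rightarrow> bool" where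
  "vanishes_at_infinity f \<longleftrightarrow> (f \<longlongrightarrow> Aff 0) (filtercomap Im at_top)"

definition nome :: "nat \<Rightarrow> complex \<Rightarrow> complex" where
  "nome N \<tau> = exp (2 * of_real pi / of_nat N * \<i> * \<tau>)"

text \<open>\<open>f = A q + B q\<^sup>2 + \<dots>\<close>. As \<open>f\<close> may take the value \<open>\<infinity>\<close>, the expansion is only required for
  large imaginary part.\<close>

definition has_q_expansion :: "nat \<Rightarrow> (complex \<Rightarrow> cp1) \<Rightarrow> complex \<Rightarrow> complex \<Rightarrow> bool" where
  "has_q_expansion N f A B \<longleftrightarrow> (\<exists>c :: nat \<Rightarrow> complex. c 0 = 0 \<and> c 1 = A \<and> c 2 = B \<and>
     (\<exists>Y>0. \<forall>\<tau>. Im \<tau> > Y \<longrightarrow>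
        f \<tau> \<noteq> Infty \<and> (\<lambda>k. c k * nome N \<tau> ^ k) sums aff (f \<tau>)))"


section \<open>The metric induced by the Poincare metric\<close>

definition poincare_density :: "complex \<Rightarrow> real" where
  "poincare_density \<tau> = 1 / Im \<tau>"

text \<open>The induced metric is \<open>|ds| = \<rho>(z) |dz|\<close> in the affine coordinate \<open>z\<close>, where \<open>\<rho>(z)\<close> is the
  number determined by the requirement that the pullback under \<open>f\<close> is the Poincare metric.\<close>

definition induced_density :: "(complex \<Rightarrow> cp1) \<Rightarrow> complex \<Rightarrow> real" where
  "induced_density f z = (THE r. \<forall>\<tau>\<in>upper_half_plane. f \<tau> = Aff z \<longrightarrow>
     r * norm (deriv (aff \<circ> f) \<tau>) = poincare_density \<tau>)"


section \<open>Polynomials in the quantities of the expansion\<close>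

type_synonym 'v mpoly = "('v \<Rightarrow>\<^sub>0 nat) \<Rightarrow>\<^sub>0 complex"

definition mpoly_vars :: "'v mpoly \<Rightarrow> 'v set" where
  "mpoly_vars p = (\<Union>\<mu>\<in>Poly_Mapping.keys p. Poly_Mapping.keys \<mu>)"

definition mpoly_eval :: "('v \<Rightarrow> complex) \<Rightarrow> 'v mpoly \<Rightarrow> complex" where
  "mpoly_eval x p = (\<Sum>\<mu>\<in>Poly_Mapping.keys p. Poly_Mapping.lookup p \<mu> *
     (\<Prod>v\<in>Poly_Mapping.keys \<mu>. x v ^ Poly_Mapping.lookup \<mu> v))"

text \<open>The variables stand for \<open>B/A\<close>, its complex conjugate, \<open>f/A\<close>, and (for given \<open>s\<close>, \<open>j\<close>, and \<open>m\<close>)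
  the quotient of \<open>(f/A)\<^sup>s\<close> times the conjugate of \<open>(f/A)\<^bsup>m-s\<^esup>\<close> by \<open>log\<^sup>j |f/A|\<close>.
  The conjugate of \<open>B/A\<close> is needed because the coefficients do not depend on \<open>A\<close> and \<open>B\<close>:
  expanding \<open>log |q|\<close> yields real parts of expressions in \<open>B/A\<close> and \<open>f/A\<close>, and the second order
  term contains \<open>|B/A|\<^sup>2\<close>.\<close>

datatype cusp_var = V_ratio | V_ratio_cnj | V_coord | V_log nat nat

definition cusp_vars :: "nat \<Rightarrow> cusp_var set" where
  "cusp_vars m = {V_ratio, V_ratio_cnj, V_coord} \<union> {V_log s j | s j. s \<le> m \<and> j \<le> m}"

fun cusp_value :: "complex \<Rightarrow> complex \<Rightarrow> nat \<Rightarrow> complex \<Rightarrow> cusp_var \<Rightarrow> complex" where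
  "cusp_value A B m z V_ratio = B / A"
| "cusp_value A B m z V_ratio_cnj = cnj (B / A)"
| "cusp_value A B m z V_coord = z / A"
| "cusp_value A B m z (V_log s j) =
     z ^ s * cnj z ^ (m - s) / (A ^ s * cnj A ^ (m - s) * of_real (ln (norm (z / A)) ^ j))"

definition cusp_term :: "(nat \<Rightarrow> cusp_var mpoly) \<Rightarrow> complex \<Rightarrow> complex \<Rightarrow> nat \<Rightarrow> complex \<Rightarrow> complex" where
  "cusp_term R A B m z = mpoly_eval (cusp_value A B m z) (R m)"

end

theory Submission
  imports Defs
begin

text \<open>Put \<open>w = f/A\<close>, \<open>x = B/A\<close>, and write the inverse of the \<open>q\<close>-expansion as \<open>q = w exp \<Phi>(w)\<close>, where
  \<open>\<Phi>(w) = \<Sum>k \<phi>\<^sub>k w\<^sup>k\<close>. Since the Poincare metric is \<open>|dq| / (|q| |log |q||)\<close>, the density at \<open>f\<close> is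
  \<open>|1 + w \<Phi>'(w)| / (|f| |log |w|| |1 + Re \<Phi>(w) / log |w||)\<close>, and expanding the quotient in terms
  that are homogeneous in \<open>w\<close> and its conjugate gives the \<open>R\<^sub>m\<close>, with coefficients that are polynomial
  in the \<open>\<phi>\<^sub>k\<close> and their conjugates.

  It remains to see that \<open>\<phi>\<^sub>k\<close> is a polynomial in \<open>x\<close> that depends on \<open>N\<close> only. Two coverings \<open>f\<^sub>0\<close>, \<open>f\<close>
  with the same deck group have the same fibres, so \<open>1/f\<close> is a function of \<open>1/f\<^sub>0\<close>, holomorphic off a
  finite set. It is injective and has a simple pole at infinity, so it is bounded near the exceptional
  points and therefore affine. Hence \<open>\<Phi>\<close> arises from \<open>\<Phi>\<^sub>0\<close> by the substitution \<open>w / (1 - c w)\<close> with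
  \<open>c = B\<^sub>0/A\<^sub>0 - x\<close>.\<close>

no_notation fps_nth (infixl "$" 75)

section \<open>Polynomials in the cusp quantities\<close>

text \<open>Here \<open>x\<close>, \<open>w\<close>, \<open>l\<close> stand for \<open>B/A\<close>, \<open>f/A\<close> and \<open>log |f/A|\<close>.\<close>

inductive cusp_poly :: "nat \<Rightarrow> (complex \<Rightarrow> complex \<Rightarrow> real \<Rightarrow> complex) \<Rightarrow> bool" where
  monomial: "s \<le> m \<Longrightarrow> j \<le> m \<Longrightarrow>
    cusp_poly m (\<lambda>x w l. c * x ^ p * cnj x ^ q * (w ^ s * cnj w ^ (m - s) / of_real (l ^ j)))"
| add: "cusp_poly m g \<Longrightarrow> cusp_poly m h \<Longrightarrow> cusp_poly m (\<lambda>x w l. g x w l + h x w l)"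

lemma cusp_poly_zero: "cusp_poly m (\<lambda>x w l. 0)"
  using cusp_poly.monomial[of 0 m 0 0 0 0] by simp

lemma cusp_poly_sum:
  assumes "finite I" "\<And>i. i \<in> I \<Longrightarrow> cusp_poly m (g i)"
  shows "cusp_poly m (\<lambda>x w l. \<Sum>i\<in>I. g i x w l)"
  using assms
proof (induction I rule: finite_induct)
  case (insert i I)
  then show ?case
    using cusp_poly.add[of m "g i" "\<lambda>x w l. \<Sum>i\<in>I. g i x w l"] by simp
qed (simp add: cusp_poly_zero)

text \<open>Degrees in \<open>w\<close> and \<open>cnj w\<close> add, and so do the powers of
  \<open>1/l\<close>. The bound on the latter is kept because each factor has at most as many powers
  of \<open>1/l\<close> as its degree.\<close>

lemma cusp_poly_mult_monomial:
  assumes "cusp_poly k h" "s \<le> m" "j \<le> m"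
  shows "cusp_poly (m + k) (\<lambda>x w l.
    (c * x ^ p * cnj x ^ q * (w ^ s * cnj w ^ (m - s) / of_real (l ^ j))) * h x w l)"
  using assms
proof (induction rule: cusp_poly.induct)
  case (monomial s' k j' c' p' q')
  have "cusp_poly (m + k) (\<lambda>x w l. (c * c') * x ^ (p + p') * cnj x ^ (q + q') *
     (w ^ (s + s') * cnj w ^ ((m + k) - (s + s')) / of_real (l ^ (j + j'))))"
    using monomial by (intro cusp_poly.monomial) auto
  moreover have "(m + k) - (s + s') = (m - s) + (k - s')"
    using monomial by simp
  ultimately show ?case
    by (simp add: power_add mult_ac)
next
  case (add k g h)
  then show ?case
    using cusp_poly.add[OF add.IH(1)[OF add.prems] add.IH(2)[OF add.prems]]
    by (simp add: ring_distribs)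
qed

lemma cusp_poly_mult:
  assumes "cusp_poly m g" "cusp_poly k h"
  shows "cusp_poly (m + k) (\<lambda>x w l. g x w l * h x w l)"
  using assms
proof (induction rule: cusp_poly.induct)
  case (monomial s m j c p q)
  then show ?case
    by (intro cusp_poly_mult_monomial)
next
  case (add m g h)
  then show ?case
    using cusp_poly.add[OF add.IH(1)[OF add.prems] add.IH(2)[OF add.prems]]
    by (simp add: ring_distribs)
qed

section \<open>Evaluation of multivariate polynomials\<close>

text \<open>Cancellation may shrink the support of a sum, so evaluations are compared over a common
  finite superset.\<close>

lemma mpoly_eval_superset:
  assumes "finite S" "Poly_Mapping.keys p \<subseteq> S"
  shows "mpoly_eval x p = (\<Sum>\<mu>\<in>S. Poly_Mapping.lookup p \<mu> *
     (\<Prod>v\<in>Poly_Mapping.keys \<mu>. x v ^ Poly_Mapping.lookup \<mu> v))"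
  unfolding mpoly_eval_def using assms
  by (intro sum.mono_neutral_left) (auto simp: in_keys_iff)

lemma mpoly_eval_add: "mpoly_eval x (p + q) = mpoly_eval x p + mpoly_eval x q"
proof -
  let ?S = "Poly_Mapping.keys p \<union> Poly_Mapping.keys q"
  have "Poly_Mapping.keys (p + q) \<subseteq> ?S"
    by (rule Poly_Mapping.keys_add)
  then show ?thesis
    by (simp add: mpoly_eval_superset[of ?S] lookup_add ring_distribs sum.distrib)
qed

lemma mpoly_vars_add: "mpoly_vars (p + q) \<subseteq> mpoly_vars p \<union> mpoly_vars q"
  using Poly_Mapping.keys_add[of p q] by (auto simp: mpoly_vars_def)

lemma mpoly_eval_single:
  assumes "finite S" "Poly_Mapping.keys \<mu> \<subseteq> S"
  shows "mpoly_eval x (Poly_Mapping.single \<mu> c) = c * (\<Prod>v\<in>S. x v ^ Poly_Mapping.lookup \<mu> v)"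
proof -
  have "mpoly_eval x (Poly_Mapping.single \<mu> c) =
    c * (\<Prod>v\<in>Poly_Mapping.keys \<mu>. x v ^ Poly_Mapping.lookup \<mu> v)"
    by (simp add: mpoly_eval_superset[of "{\<mu>}"])
  also have "(\<Prod>v\<in>Poly_Mapping.keys \<mu>. x v ^ Poly_Mapping.lookup \<mu> v) =
      (\<Prod>v\<in>S. x v ^ Poly_Mapping.lookup \<mu> v)"
    using assms by (intro prod.mono_neutral_left) (auto simp: in_keys_iff)
  finally show ?thesis .
qed

text \<open>Passes from functions to polynomials as syntactic objects. The identity also covers
  \<open>A = 0\<close> and a vanishing logarithm, since both sides follow the same convention for
  division by zero.\<close>

lemma cusp_poly_imp_mpoly:
  assumes "cusp_poly m g"
  shows "\<exists>p. mpoly_vars p \<subseteq> cusp_vars m \<and>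
    (\<forall>A B z. mpoly_eval (cusp_value A B m z) p = g (B / A) (z / A) (ln (norm (z / A))))"
  using assms
proof (induction rule: cusp_poly.induct)
  case (monomial s m j c a b)
  define \<mu> :: "cusp_var \<Rightarrow>\<^sub>0 nat" where
    "\<mu> = Poly_Mapping.single V_ratio a + Poly_Mapping.single V_ratio_cnj b
         + Poly_Mapping.single (V_log s j) 1"
  let ?S = "{V_ratio, V_ratio_cnj, V_log s j}"
  have keys: "Poly_Mapping.keys \<mu> \<subseteq> ?S"
    by (auto simp: \<mu>_def in_keys_iff lookup_add lookup_single when_def split: if_splits)
  have "mpoly_vars (Poly_Mapping.single \<mu> c) \<subseteq> ?S"
    using keys by (auto simp: mpoly_vars_def split: if_splits)
  also have "\<dots> \<subseteq> cusp_vars m"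
    using monomial by (auto simp: cusp_vars_def)
  finally have vars: "mpoly_vars (Poly_Mapping.single \<mu> c) \<subseteq> cusp_vars m" .
  have "mpoly_eval (cusp_value A B m z) (Poly_Mapping.single \<mu> c) =
      c * (B / A) ^ a * cnj (B / A) ^ b *
      ((z / A) ^ s * cnj (z / A) ^ (m - s) / of_real (ln (norm (z / A)) ^ j))" for A B z
    unfolding mpoly_eval_single[of ?S, OF _ keys, simplified]
    by (simp add: \<mu>_def lookup_add lookup_single when_def power_divide divide_inverse mult_ac
        power_mult_distrib power_inverse)
  then show ?case
    by (intro exI[of _ "Poly_Mapping.single \<mu> c"]) (simp only: vars simp_thms)
next
  case (add m g h)
  then obtain p q where "mpoly_vars p \<subseteq> cusp_vars m" "mpoly_vars q \<subseteq> cusp_vars m"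
    "\<forall>A B z. mpoly_eval (cusp_value A B m z) p = g (B / A) (z / A) (ln (norm (z / A)))"
    "\<forall>A B z. mpoly_eval (cusp_value A B m z) q = h (B / A) (z / A) (ln (norm (z / A)))"
    by blast
  then show ?case
    using mpoly_vars_add[of p q] by (intro exI[of _ "p + q"]) (auto simp: mpoly_eval_add)
qed

text \<open>The coefficients in \<open>t\<close> of \<open>(1 + \<Sum>k \<phi>\<^sub>k (tw)\<^sup>k) / (1 + \<Sum> Re (\<phi>\<^sub>k w\<^sup>k) t\<^sup>k / l)\<close>.\<close>

fun cusp_coeff :: "(nat \<Rightarrow> complex) \<Rightarrow> complex \<Rightarrow> real \<Rightarrow> nat \<Rightarrow> complex" where
  "cusp_coeff \<phi> w l m = (if m = 0 then 1 else of_nat m * \<phi> m * w ^ m) -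
     (\<Sum>i<m. of_real (Re (\<phi> (m - i) * w ^ (m - i)) / l) * cusp_coeff \<phi> w l i)"

declare cusp_coeff.simps [simp del]

text \<open>\<open>Re u = (u + cnj u) / 2\<close> is where the conjugates of \<open>x\<close> and
  \<open>w\<close> enter. Dividing by \<open>l\<close> needs \<open>j = 1\<close>, which is
  admissible only for \<open>0 < k\<close>.\<close>

lemma cusp_poly_poly:
  assumes "0 < k"
  shows "cusp_poly k (\<lambda>x w l. poly p x * w ^ k)"
    and "cusp_poly k (\<lambda>x w l. of_real (Re (poly p x * w ^ k) / l))"
proof -
  have "cusp_poly k (\<lambda>x w l. \<Sum>i\<le>degree p. coeff p i * x ^ i * cnj x ^ 0 * (w ^ k * cnj w ^ (k - k) / of_real (l ^ 0)))"
    by (intro cusp_poly_sum cusp_poly.monomial) auto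
  then show "cusp_poly k (\<lambda>x w l. poly p x * w ^ k)"
    by (simp add: poly_altdef sum_distrib_right)
  have "cusp_poly k (\<lambda>x w l. (\<Sum>i\<le>degree p. (coeff p i / 2) * x ^ i * cnj x ^ 0 *
        (w ^ k * cnj w ^ (k - k) / of_real (l ^ 1))) +
      (\<Sum>i\<le>degree p. (cnj (coeff p i) / 2) * x ^ 0 * cnj x ^ i *
        (w ^ 0 * cnj w ^ (k - 0) / of_real (l ^ 1))))"
    using assms by (intro cusp_poly_sum cusp_poly.monomial cusp_poly.add) auto
  also have "(\<lambda>x w l. (\<Sum>i\<le>degree p. (coeff p i / 2) * x ^ i * cnj x ^ 0 *
        (w ^ k * cnj w ^ (k - k) / of_real (l ^ 1))) +
      (\<Sum>i\<le>degree p. (cnj (coeff p i) / 2) * x ^ 0 * cnj x ^ i *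
        (w ^ 0 * cnj w ^ (k - 0) / of_real (l ^ 1)))) =
      (\<lambda>x w l. of_real (Re (poly p x * w ^ k) / l))" (is "?L = ?R")
  proof (intro ext)
    fix x w :: complex and l :: real
    have "?L x w l = (poly p x * w ^ k + cnj (poly p x * w ^ k)) / 2 / of_real l"
      by (simp add: poly_altdef sum_distrib_left sum_divide_distrib add_divide_distrib mult_ac)
    also have "\<dots> = ?R x w l"
      by (subst complex_add_cnj) (simp del: times_complex.sel)
    finally show "?L x w l = ?R x w l" .
  qed
  finally show "cusp_poly k (\<lambda>x w l. of_real (Re (poly p x * w ^ k) / l))" .
qed

text \<open>Induction along the recursion: the summand with index \<open>i\<close> is a product of
  degrees \<open>m - i\<close> and \<open>i\<close>. One polynomial represents
  \<open>\<phi> x k\<close> for all \<open>x\<close>, which makes the resulting coefficients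
  constant.\<close>

lemma cusp_poly_cusp_coeff:
  assumes "\<And>k. 0 < k \<Longrightarrow> \<exists>p. \<forall>x. \<phi> x k = poly p x"
  shows "cusp_poly m (\<lambda>x w l. cusp_coeff (\<phi> x) w l m)"
proof (induction m rule: less_induct)
  case (less m)
  define P where "P k = (SOME p. \<forall>x. \<phi> x k = poly p x)" for k
  have P: "\<phi> x k = poly (P k) x" if "0 < k" for x k
    using someI_ex[OF assms[OF that]] unfolding P_def by (rule spec)
  show ?case
  proof (cases "m = 0")
    case True
    then show ?thesis
      using cusp_poly.monomial[of 0 0 0 1 0 0] by (subst cusp_coeff.simps) simp
  next
    case False
    \<comment> \<open>Negating \<open>P\<close> turns the subtraction in the recursion into a sum,
      under which \<open>cusp_poly\<close> is closed.\<close>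
    have summand: "cusp_poly m (\<lambda>x w l. of_real (Re (poly (- P (m - i)) x * w ^ (m - i)) / l)
         * cusp_coeff (\<phi> x) w l i)" if "i < m" for i
      using cusp_poly_mult[OF cusp_poly_poly(2)[of "m - i" "- P (m - i)"] less[OF that]] that
      by (simp del: times_complex.sel poly_minus)
    have "cusp_poly m (\<lambda>x w l. poly (smult (of_nat m) (P m)) x * w ^ m +
        (\<Sum>i<m. of_real (Re (poly (- P (m - i)) x * w ^ (m - i)) / l) * cusp_coeff (\<phi> x) w l i))"
      using False summand by (intro cusp_poly.add cusp_poly_sum cusp_poly_poly(1) summand) simp_all
    then show ?thesis
      using False P by (subst cusp_coeff.simps) (simp add: sum_negf del: times_complex.sel)
  qed
qed

section \<open>Convergence\<close>

text \<open>With \<open>q = K * norm w\<close>, the induction hypothesis bounds the summand with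
  index \<open>i\<close> by \<open>q ^ m * 3 ^ i\<close>. Together with the leading term the
  geometric sum gives \<open>q ^ m * ((3 ^ m + 1) / 2)\<close>, so the ratio 3 closes the induction.
  The condition \<open>1 \<le> \<bar>l\<bar>\<close> absorbs the division by
  \<open>l\<close>.\<close>

lemma norm_cusp_coeff_le:
  assumes K: "\<And>k. 0 < k \<Longrightarrow> norm (of_nat k * \<phi> k) \<le> K ^ k" and l: "1 \<le> \<bar>l\<bar>" and "0 \<le> K"
  shows "norm (cusp_coeff \<phi> w l m) \<le> (3 * K * norm w) ^ m"
proof (induction m rule: less_induct)
  case (less m)
  let ?q = "K * norm w"
  have q: "0 \<le> ?q"
    using \<open>0 \<le> K\<close> by simp
  have \<phi>: "norm (\<phi> k) * norm w ^ k \<le> ?q ^ k" if "0 < k" for k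
  proof -
    have "norm (\<phi> k) \<le> norm (of_nat k * \<phi> k)"
      using that by (simp add: norm_mult mult_le_cancel_right1)
    then have "norm (\<phi> k) \<le> K ^ k"
      using K[OF that] by simp
    then show ?thesis
      by (simp add: power_mult_distrib mult_right_mono)
  qed
  have summand: "norm (of_real (Re (\<phi> (m - i) * w ^ (m - i)) / l) * cusp_coeff \<phi> w l i) \<le> ?q ^ m * 3 ^ i"
    if "i < m" for i
  proof -
    have "norm (of_real (Re (\<phi> (m - i) * w ^ (m - i)) / l) :: complex)
        = \<bar>Re (\<phi> (m - i) * w ^ (m - i))\<bar> / \<bar>l\<bar>"
      by (simp only: norm_of_real abs_divide)
    also have "\<dots> \<le> \<bar>Re (\<phi> (m - i) * w ^ (m - i))\<bar> / 1"
      using l by (intro divide_left_mono) auto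
    also have "\<dots> \<le> norm (\<phi> (m - i) * w ^ (m - i))"
      using abs_Re_le_cmod by (simp del: times_complex.sel)
    also have "\<dots> \<le> ?q ^ (m - i)"
      using \<phi>[of "m - i"] that by (simp add: norm_mult norm_power)
    finally have "norm (of_real (Re (\<phi> (m - i) * w ^ (m - i)) / l) * cusp_coeff \<phi> w l i)
        \<le> ?q ^ (m - i) * (3 * K * norm w) ^ i"
      unfolding norm_mult using less[OF that] q by (intro mult_mono) auto
    also have "\<dots> = ?q ^ (m - i) * ?q ^ i * 3 ^ i"
      by (simp add: power_mult_distrib)
    also have "?q ^ (m - i) * ?q ^ i = ?q ^ m"
      using that by (simp flip: power_add)
    finally show ?thesis .
  qed
  have geom: "(\<Sum>i<m. 3 ^ i) = ((3::real) ^ m - 1) / 2"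
    by (simp add: geometric_sum)
  have "norm (if m = 0 then 1 else of_nat m * \<phi> m * w ^ m) \<le> ?q ^ m"
    using K[of m] by (simp add: norm_mult norm_power power_mult_distrib mult_right_mono)
  moreover have "norm (\<Sum>i<m. of_real (Re (\<phi> (m - i) * w ^ (m - i)) / l) * cusp_coeff \<phi> w l i)
      \<le> (\<Sum>i<m. ?q ^ m * 3 ^ i)"
    using summand by (intro sum_norm_le) auto
  ultimately have "norm (cusp_coeff \<phi> w l m) \<le> ?q ^ m + (\<Sum>i<m. ?q ^ m * 3 ^ i)"
    by (subst cusp_coeff.simps) (rule order_trans[OF norm_triangle_ineq4 add_mono])
  also have "\<dots> = ?q ^ m * ((3 ^ m + 1) / 2)"
    by (simp add: geom flip: sum_distrib_left) (simp add: field_simps)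
  also have "\<dots> \<le> ?q ^ m * 3 ^ m"
    using q by (intro mult_left_mono) auto
  finally show ?case
    by (simp add: power_mult_distrib mult_ac)
qed

lemma summable_norm_cusp_coeff:
  assumes "\<And>k. 0 < k \<Longrightarrow> norm (of_nat k * \<phi> k) \<le> K ^ k" "1 \<le> \<bar>l\<bar>" "0 \<le> K"
    and small: "3 * K * norm w < 1"
  shows "summable (\<lambda>m. norm (cusp_coeff \<phi> w l m))"
  using norm_cusp_coeff_le[OF assms(1-3)] small \<open>0 \<le> K\<close>
  by (intro summable_comparison_test'[OF summable_geometric[of "3 * K * norm w"]]) auto

text \<open>A geometric tail with ratio at most \<open>1/2\<close>, whence the factor 2. It controls
  the remainder after any number of terms.\<close>

lemma suminf_cusp_coeff_tail_le:
  assumes "\<And>k. 0 < k \<Longrightarrow> norm (of_nat k * \<phi> k) \<le> K ^ k" "1 \<le> \<bar>l\<bar>" "0 \<le> K"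
    and small: "3 * K * norm w \<le> 1 / 2"
  shows "norm (suminf (\<lambda>m. cusp_coeff \<phi> w l (m + n))) \<le> 2 * (3 * K * norm w) ^ n"
proof -
  let ?r = "3 * K * norm w"
  have r: "0 \<le> ?r"
    using \<open>0 \<le> K\<close> by simp
  have "norm (suminf (\<lambda>m. cusp_coeff \<phi> w l (m + n))) \<le> suminf (\<lambda>m. ?r ^ n * ?r ^ m)"
  proof (rule norm_suminf_le)
    show "summable (\<lambda>m. ?r ^ n * ?r ^ m)"
      using r small by (intro summable_mult summable_geometric) auto
  qed (use norm_cusp_coeff_le[OF assms(1-3)] in \<open>simp flip: power_add add: add.commute\<close>)
  also have "\<dots> = ?r ^ n * (1 / (1 - ?r))"
    using r small by (simp add: suminf_mult suminf_geometric summable_geometric)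
  also have "\<dots> \<le> ?r ^ n * 2"
    using small by (intro mult_left_mono zero_le_power r) (auto simp: field_simps)
  finally show ?thesis
    by (simp add: mult.commute)
qed

text \<open>The recursion for \<open>cusp_coeff\<close> is the Cauchy product of denominator and
  quotient, read coefficientwise; absolute convergence of both series turns it into an identity of
  sums.\<close>

lemma suminf_cusp_coeff:
  assumes K: "\<And>k. 0 < k \<Longrightarrow> norm (of_nat k * \<phi> k) \<le> K ^ k" and l: "1 \<le> \<bar>l\<bar>" and "0 \<le> K"
    and small: "3 * K * norm w < 1" and "\<phi> 0 = 0"
    and \<Phi>: "(\<lambda>k. \<phi> k * w ^ k) sums \<Phi>" and D: "(\<lambda>k. of_nat k * \<phi> k * w ^ k) sums D"
  shows "suminf (cusp_coeff \<phi> w l) * of_real (1 + Re \<Phi> / l) = 1 + D"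
proof -
  define a where "a k = (of_real (if k = 0 then 1 else Re (\<phi> k * w ^ k) / l) :: complex)" for k
  have a0: "a 0 = 1"
    by (simp add: a_def)
  have "(\<lambda>k. Re (\<phi> k * w ^ k) / l) sums (Re \<Phi> / l)"
    using \<Phi> by (intro sums_divide sums_Re)
  then have "(\<lambda>k. Re (\<phi> k * w ^ k) / l + (if k = 0 then 1 else 0)) sums (Re \<Phi> / l + 1)"
    using sums_single[of 0 "\<lambda>_. 1"] by (intro sums_add) auto
  also have "(\<lambda>k. Re (\<phi> k * w ^ k) / l + (if k = 0 then 1 else 0)) =
      (\<lambda>k. if k = 0 then 1 else Re (\<phi> k * w ^ k) / l)"
    using \<open>\<phi> 0 = 0\<close> by auto
  finally have a: "a sums of_real (1 + Re \<Phi> / l)"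
    unfolding a_def sums_of_real_iff by (simp add: add.commute)
  have abs_a: "summable (\<lambda>k. norm (a k))"
  proof (rule summable_comparison_test'[OF summable_geometric[of "K * norm w"]])
    show "norm (K * norm w) < 1"
      using small \<open>0 \<le> K\<close> by (auto simp: abs_mult)
    fix k :: nat
    show "norm (norm (a k)) \<le> (K * norm w) ^ k"
    proof (cases "k = 0")
      case False
      have "norm (a k) = \<bar>Re (\<phi> k * w ^ k)\<bar> / \<bar>l\<bar>"
        using False by (simp only: a_def norm_of_real abs_divide if_False)
      also have "\<dots> \<le> \<bar>Re (\<phi> k * w ^ k)\<bar> / 1"
        using l by (intro divide_left_mono) auto
      also have "\<dots> \<le> norm (\<phi> k * w ^ k)"
        using abs_Re_le_cmod by (simp del: times_complex.sel)
      also have "\<dots> \<le> norm (of_nat k * \<phi> k) * norm w ^ k"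
        using False by (auto simp: norm_mult norm_power mult_le_cancel_right1 intro!: mult_right_mono)
      also have "\<dots> \<le> (K * norm w) ^ k"
        using K[of k] False by (auto simp: power_mult_distrib intro!: mult_right_mono)
      finally show ?thesis
        by simp
    qed (simp add: a_def)
  qed
  let ?V = "cusp_coeff \<phi> w l"
  have "(\<lambda>k. \<Sum>i\<le>k. a i * ?V (k - i)) sums (suminf a * suminf ?V)"
    by (intro Cauchy_product_sums abs_a summable_norm_cusp_coeff[OF K l \<open>0 \<le> K\<close> small])
  moreover have "(\<Sum>i\<le>k. a i * ?V (k - i)) = of_nat k * \<phi> k * w ^ k + (if k = 0 then 1 else 0)" for k
  proof -
    have "(\<Sum>i\<le>k. a i * ?V (k - i)) = (\<Sum>i\<le>k. a (k - i) * ?V i)"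
      by (rule sum.reindex_bij_witness[of _ "\<lambda>i. k - i" "\<lambda>i. k - i"]) auto
    also have "\<dots> = (\<Sum>i<k. a (k - i) * ?V i) + ?V k"
      by (simp add: lessThan_Suc_atMost[symmetric] a0)
    also have "(\<Sum>i<k. a (k - i) * ?V i) =
        (\<Sum>i<k. of_real (Re (\<phi> (k - i) * w ^ (k - i)) / l) * ?V i)"
      by (intro sum.cong) (auto simp: a_def simp del: times_complex.sel)
    also have "\<dots> + ?V k = (if k = 0 then 1 else of_nat k * \<phi> k * w ^ k)"
      by (subst (2) cusp_coeff.simps) (simp only: add_diff_cancel_left' diff_add_cancel add_diff_eq)
    finally show ?thesis
      by simp
  qed
  moreover have "(\<lambda>k. of_nat k * \<phi> k * w ^ k + (if k = 0 then 1 else 0)) sums (D + 1)"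
    using D sums_single[of 0 "\<lambda>_. 1"] by (intro sums_add) auto
  ultimately have "suminf a * suminf ?V = D + 1"
    using sums_unique2 by force
  then show ?thesis
    using sums_unique[OF a] by (simp add: mult.commute add.commute)
qed

lemma cusp_coeff_Suc_0: "cusp_coeff \<phi> w l (Suc 0) = \<phi> 1 * w - of_real (Re (\<phi> 1 * w) / l)"
proof -
  have "cusp_coeff \<phi> w l 0 = 1"
    by (subst cusp_coeff.simps) simp
  then show ?thesis
    by (subst cusp_coeff.simps) (simp del: times_complex.sel)
qed

text \<open>\<open>fps_X * fps_deriv F\<close> has the coefficients \<open>k * fps_nth F k\<close>
  and still converges near 0, so they are bounded geometrically. The weight \<open>k\<close> makes
  one \<open>K\<close> serve for both \<Phi> and \<open>w * deriv \<Phi> w\<close>.\<close>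

lemma fps_conv_radius_pos_imp_bound:
  fixes F :: "complex fps"
  assumes "fps_conv_radius F > 0"
  obtains K where "0 < K" "\<And>k. 0 < k \<Longrightarrow> norm (of_nat k * fps_nth F k) \<le> K ^ k"
proof -
  have "fps_conv_radius (fps_X * fps_deriv F) > 0"
  proof -
    have "0 < min (fps_conv_radius (fps_X :: complex fps)) (fps_conv_radius (fps_deriv F))"
      using less_le_trans[OF assms fps_conv_radius_deriv] by simp
    then show ?thesis
      using fps_conv_radius_mult less_le_trans by blast
  qed
  then obtain r where r: "0 < r" "ereal r < fps_conv_radius (fps_X * fps_deriv F)"
    using ereal_dense2[of 0] by (metis ereal_less(2))
  have "summable (\<lambda>k. norm (fps_nth (fps_X * fps_deriv F) k * of_real r ^ k))"
    using r by (intro norm_summable_fps) auto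
  from summable_imp_Bseq[OF this] obtain C where
    C: "0 < C" "norm (norm (fps_nth (fps_X * fps_deriv F) k * of_real r ^ k)) \<le> C" for k
    by (auto elim: BseqE)
  \<comment> \<open>As \<open>max 1 C\<close> is at least 1, the constant is absorbed into the
    \<open>k\<close>-th power for \<open>0 < k\<close>.\<close>
  have "norm (of_nat k * fps_nth F k) \<le> (max 1 C / r) ^ k" if "0 < k" for k
  proof -
    have "fps_nth (fps_X * fps_deriv F) k = of_nat k * fps_nth F k"
      using that by simp
    then have "norm (of_nat k * fps_nth F k) * r ^ k \<le> max 1 C"
      using C(2)[of k] r by (simp add: norm_mult norm_power)
    also have "\<dots> \<le> max 1 C ^ k"
      using that power_increasing[of 1 k "max 1 C"] by simp
    finally show ?thesis
      using r by (simp add: power_divide field_simps)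
  qed
  then show ?thesis
    using that[of "max 1 C / r"] r by simp
qed

section \<open>Dependence on the second coefficient\<close>

text \<open>If \<open>P\<close> expands \<open>\<Phi>\<close> at \<open>0\<close>, this is the expansion of \<open>\<Phi>(w / (1 - c w)) - log (1 - c w)\<close>, which
  corresponds to replacing \<open>f\<close> by \<open>f / (1 + c f)\<close>.\<close>

definition change_coord :: "complex fps \<Rightarrow> complex \<Rightarrow> complex fps" where
  "change_coord P c = fps_compose P (fps_X * Abs_fps (\<lambda>k. c ^ k)) + Abs_fps (\<lambda>k. c ^ k / of_nat k)"

text \<open>The source of the polynomial dependence on \<open>B/A\<close>. The inner series has no
  constant term, so coefficient \<open>k\<close> of the composition involves only its powers
  \<open>i \<le> k\<close>, whose coefficients are polynomial in \<open>c\<close>.\<close>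

lemma fps_nth_change_coord_poly: "\<exists>p. \<forall>c. fps_nth (change_coord P c) k = poly p c"
proof -
  have base: "\<exists>p. \<forall>c::complex. fps_nth (fps_X * Abs_fps (\<lambda>k. c ^ k)) n = poly p c" for n :: nat
  proof (cases n)
    case 0
    then show ?thesis
      by (intro exI[of _ 0]) simp
  next
    case (Suc k)
    then show ?thesis
      by (intro exI[of _ "monom 1 k"]) (simp add: poly_monom)
  qed
  have pow: "\<exists>p. \<forall>c::complex. fps_nth ((fps_X * Abs_fps (\<lambda>k. c ^ k)) ^ i) n = poly p c" for i n :: nat
  proof (induction i arbitrary: n)
    case 0
    show ?case
      by (intro exI[of _ "[:if n = 0 then 1 else 0:]"]) simp
  next
    case (Suc i)
    obtain p where p: "fps_nth ((fps_X * Abs_fps (\<lambda>k. c ^ k)) ^ i) n = poly (p n) c" for c :: complex and n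
      using Suc by metis
    obtain b where b: "fps_nth (fps_X * Abs_fps (\<lambda>k. c ^ k)) n = poly (b n) c" for c :: complex and n
      using base by metis
    show ?case
      by (intro exI[of _ "\<Sum>j=0..n. b j * p (n - j)"])
        (simp only: power_Suc fps_mult_nth[of "fps_X * _"] p b poly_sum poly_mult simp_thms)
  qed
  have "\<forall>i. \<exists>p. \<forall>c::complex. fps_nth ((fps_X * Abs_fps (\<lambda>k. c ^ k)) ^ i) k = poly p c"
    by (intro allI pow)
  from choice[OF this] obtain p where
    p: "\<forall>i. \<forall>c::complex. fps_nth ((fps_X * Abs_fps (\<lambda>k. c ^ k)) ^ i) k = poly (p i) c" ..
  show ?thesis
    by (intro exI[of _ "(\<Sum>i=0..k. smult (fps_nth P i) (p i)) + monom (1 / of_nat k) k"])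
      (simp only: change_coord_def fps_add_nth fps_compose_nth p poly_add poly_sum poly_smult
        poly_monom fps_nth_Abs_fps times_divide_eq_left mult_1_left simp_thms)
qed

lemma fps_nth_change_coord_1: "fps_nth (change_coord P c) 1 = fps_nth P 1 + c"
  by (simp add: change_coord_def fps_compose_nth)

lemma has_fps_expansion_change_coord:
  assumes "\<Phi> has_fps_expansion P"
  shows "(\<lambda>w. \<Phi> (w / (1 - c * w)) - Ln (1 - c * w)) has_fps_expansion change_coord P c"
proof -
  have small: "eventually (\<lambda>w. norm (c * w) < 1) (nhds 0)"
  proof -
    have "((\<lambda>w. norm (c * w)) \<longlongrightarrow> norm (c * 0)) (nhds 0)"
      by (intro tendsto_intros filterlim_ident)
    then show ?thesis
      by (rule order_tendstoD) simp
  qed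
  have "(\<lambda>w. 1 / (1 - c * w)) has_fps_expansion Abs_fps (\<lambda>k. c ^ k)"
  proof (rule has_fps_expansionI, rule eventually_mono[OF small])
    fix w assume "norm (c * w) < 1"
    then show "(\<lambda>n. fps_nth (Abs_fps (\<lambda>k. c ^ k)) n * w ^ n) sums (1 / (1 - c * w))"
      using geometric_sums[of "c * w"] by (simp add: power_mult_distrib)
  qed
  from has_fps_expansion_mult[OF has_fps_expansion_fps_X this]
  have "(\<lambda>w. w / (1 - c * w)) has_fps_expansion (fps_X * Abs_fps (\<lambda>k. c ^ k))"
    by simp
  from has_fps_expansion_compose[OF assms this]
  have 1: "(\<lambda>w. \<Phi> (w / (1 - c * w))) has_fps_expansion fps_compose P (fps_X * Abs_fps (\<lambda>k. c ^ k))"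
    by (simp add: o_def)
  \<comment> \<open>At index 0 the coefficient is a division by zero, hence 0, as the logarithm has
    no constant term.\<close>
  have 2: "(\<lambda>w. - Ln (1 - c * w)) has_fps_expansion Abs_fps (\<lambda>k. c ^ k / of_nat k)"
  proof (rule has_fps_expansionI, rule eventually_mono[OF small])
    fix w assume "norm (c * w) < 1"
    then have "(\<lambda>n. - (- ((- (- (c * w))) ^ n) / of_nat n)) sums (- Ln (1 + (- (c * w))))"
      by (intro sums_minus Ln_series') simp
    then show "(\<lambda>n. fps_nth (Abs_fps (\<lambda>k. c ^ k / of_nat k)) n * w ^ n) sums (- Ln (1 - c * w))"
      by (simp add: power_mult_distrib)
  qed
  show ?thesis
    using has_fps_expansion_add[OF 1 2] by (simp add: change_coord_def)
qed

section \<open>Coverings of the punctured sphere\<close>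

text \<open>The inverse of the chart \<open>1/z\<close>. In this chart the puncture 0 lies at
  infinity, so the covering becomes a map onto the plane minus a finite set.\<close>

definition of_inf :: "complex \<Rightarrow> cp1" where
  "of_inf w = (if w = 0 then Infty else Aff (1 / w))"

lemma aff_inf_of_inf [simp]: "aff_inf (of_inf w) = w"
  by (simp add: of_inf_def)

lemma of_inf_aff_inf: "x \<noteq> Aff 0 \<Longrightarrow> of_inf (aff_inf x) = x"
  by (cases x) (auto simp: of_inf_def)

lemma of_inf_neq [simp]: "of_inf w \<noteq> Aff 0"
  by (simp add: of_inf_def)

lemma open_cp1_compl_0: "open (UNIV - {Aff 0})"
proof -
  have "Aff -` (UNIV - {Aff 0}) = - {0}"
    by auto
  moreover have "\<forall>\<^sub>F z :: complex in at_infinity. z \<noteq> 0"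
    by (rule eventually_not_equal_at_infinity)
  ultimately show ?thesis
    by (simp add: open_cp1_def open_Compl)
qed

lemma continuous_on_aff_inf: "continuous_on (UNIV - {Aff 0}) aff_inf"
proof -
  have "open (aff_inf -` U \<inter> (UNIV - {Aff 0}))" if U: "open U" for U
  proof -
    have "Aff -` (aff_inf -` U \<inter> (UNIV - {Aff 0})) = (\<lambda>z. 1 / z) -` U \<inter> - {0}"
      by auto
    moreover have "continuous_on (- {0}) (\<lambda>z :: complex. 1 / z)"
      by (intro continuous_intros) auto
    then have "open ((\<lambda>z :: complex. 1 / z) -` U \<inter> - {0})"
      using U continuous_on_open_vimage[of "- {0}" "\<lambda>z :: complex. 1 / z"] by (simp add: open_Compl)
    moreover have "\<forall>\<^sub>F z in at_infinity. aff_inf (Aff z) \<in> U \<and> z \<noteq> 0" if "0 \<in> U"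
      using topological_tendstoD[OF tendsto_inverse_0 U that]
        eventually_not_equal_at_infinity[of "0 :: complex"]
      by eventually_elim (simp add: divide_inverse)
    ultimately show ?thesis
      by (simp add: open_cp1_def)
  qed
  then show ?thesis
    by (simp add: continuous_on_open_vimage open_cp1_compl_0)
qed

lemma continuous_on_of_inf: "continuous_on UNIV of_inf"
proof -
  have "open (of_inf -` U)" if U: "open U" for U
  proof -
    have "eventually (\<lambda>w. of_inf w \<in> U) (nhds w0)" if w0: "of_inf w0 \<in> U" for w0
    proof (cases "w0 = 0")
      case True
      then have "\<forall>\<^sub>F z in at_infinity. Aff z \<in> U"
        using U w0 by (auto simp: open_cp1_def of_inf_def)
      then have "\<forall>\<^sub>F w in at 0. Aff (inverse w) \<in> U"
        by (rule eventually_compose_filterlim[OF _ filterlim_inverse_at_infinity])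
      then have "\<forall>\<^sub>F w in at 0. of_inf w \<in> U"
        using eventually_neq_at_within[of "0 :: complex"]
        by eventually_elim (simp add: of_inf_def divide_inverse)
      then show ?thesis
        unfolding True eventually_at_filter by (elim eventually_mono) (use True w0 in auto)
    next
      case False
      have "open (Aff -` U)"
        using U by (simp add: open_cp1_def)
      moreover have "((\<lambda>w. 1 / w) \<longlongrightarrow> 1 / w0) (nhds w0)"
        using False by (intro tendsto_intros filterlim_ident) auto
      ultimately have "\<forall>\<^sub>F w in nhds w0. 1 / w \<in> Aff -` U"
        using topological_tendstoD w0 False by (fastforce simp: of_inf_def)
      moreover have "\<forall>\<^sub>F w in nhds w0. w \<noteq> 0"
        using False t1_space_nhds by blast
      ultimately show ?thesis
        by eventually_elim (simp add: of_inf_def)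
    qed
    then show ?thesis
      by (subst open_subopen) (auto simp: eventually_nhds subset_eq)
  qed
  then show ?thesis
    by (simp add: continuous_on_open_vimage)
qed

lemma homeomorphism_aff_inf: "homeomorphism (UNIV - {Aff 0}) UNIV aff_inf of_inf"
  by (intro homeomorphismI continuous_on_aff_inf continuous_on_of_inf)
    (auto simp: of_inf_aff_inf)

section \<open>Covering maps and deck transformations\<close>

text \<open>Evenly covered sets go to their images under \<open>h\<close> with the same sheets,
  because \<open>h\<close> is injective on \<open>S\<close>. This moves the covering from the
  projective line to the plane.\<close>

lemma covering_space_homeomorphism_compose:
  assumes cov: "covering_space c p S" and hom: "homeomorphism S T h k"
  shows "covering_space c (h \<circ> p) T"
proof
  show "continuous_on c (h \<circ> p)"
    using cov hom by (metis continuous_on_compose covering_space_def homeomorphism_cont1)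
  show "(h \<circ> p) ` c = T"
    using cov hom by (metis covering_space_def homeomorphism_image1 image_comp)
  fix y assume "y \<in> T"
  then have "k y \<in> S"
    using hom by (auto simp: homeomorphism_def)
  then obtain U v where U: "k y \<in> U" "openin (top_of_set S) U" and v: "\<Union>v = c \<inter> p -` U"
      "\<forall>u\<in>v. openin (top_of_set c) u" "pairwise disjnt v" "\<forall>u\<in>v. \<exists>q. homeomorphism u U p q"
    using cov unfolding covering_space_def by meson
  have "U \<subseteq> S"
    using U(2) openin_imp_subset by blast
  show "\<exists>U'. y \<in> U' \<and> openin (top_of_set T) U' \<and> (\<exists>v. \<Union>v = c \<inter> (h \<circ> p) -` U' \<and>
      (\<forall>u\<in>v. openin (top_of_set c) u) \<and> pairwise disjnt v \<and> (\<forall>u\<in>v. \<exists>q. homeomorphism u U' (h \<circ> p) q))"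
  proof (intro exI conjI)
    show "y \<in> h ` U"
      using U(1) hom \<open>y \<in> T\<close> by (metis homeomorphism_apply2 imageI)
    show "openin (top_of_set T) (h ` U)"
      using hom U(2) by (rule homeomorphism_imp_open_map)
    have "p x \<in> U" if "x \<in> c" "u \<in> U" "h (p x) = h u" for x u
    proof -
      have "p x \<in> S"
        using cov that(1) by (auto simp: covering_space_def)
      then show ?thesis
        using that \<open>U \<subseteq> S\<close> hom by (metis homeomorphism_apply1 subsetD)
    qed
    then have "c \<inter> (h \<circ> p) -` (h ` U) = c \<inter> p -` U"
      by auto
    then show "\<Union>v = c \<inter> (h \<circ> p) -` (h ` U)"
      using v(1) by simp
    have "homeomorphism U (h ` U) h k"
      using hom \<open>U \<subseteq> S\<close> by (rule homeomorphism_of_subsets) (use hom \<open>U \<subseteq> S\<close> in \<open>auto simp: homeomorphism_def\<close>)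
    then show "\<forall>u\<in>v. \<exists>q. homeomorphism u (h ` U) (h \<circ> p) q"
      using v(4) homeomorphism_compose by blast
  qed (use v in auto)
qed

text \<open>Lifting \<open>p\<close> through itself gives \<open>\<phi>\<close> sending
  \<open>x\<close> to \<open>y\<close> and \<open>\<psi>\<close> sending \<open>y\<close> to
  \<open>x\<close>. Each composite and the identity are lifts of \<open>p\<close> that agree at one
  point, hence coincide.\<close>

lemma covering_space_deck_transitive:
  fixes p :: "'a::real_normed_vector \<Rightarrow> 'b::real_normed_vector"
  assumes cov: "covering_space C p S" and "simply_connected C" "locally path_connected C"
    and "x \<in> C" "y \<in> C" "p x = p y"
  obtains \<phi> \<psi> where "homeomorphism C C \<phi> \<psi>" "\<phi> x = y" "\<And>z. z \<in> C \<Longrightarrow> p (\<phi> z) = p z"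
proof -
  have contp: "continuous_on C p" and pim: "p \<in> C \<rightarrow> S"
    using cov by (auto simp: covering_space_def)
  have "connected C"
    using assms(2) by (rule simply_connected_imp_connected)
  obtain \<phi> where \<phi>: "continuous_on C \<phi>" "\<phi> \<in> C \<rightarrow> C" "\<phi> x = y" "\<And>z. z \<in> C \<Longrightarrow> p (\<phi> z) = p z"
    by (rule covering_space_lift_strong[OF cov \<open>y \<in> C\<close> \<open>x \<in> C\<close> assms(2,3) contp pim \<open>p x = p y\<close>]) blast
  obtain \<psi> where \<psi>: "continuous_on C \<psi>" "\<psi> \<in> C \<rightarrow> C" "\<psi> y = x" "\<And>z. z \<in> C \<Longrightarrow> p (\<psi> z) = p z"
    by (rule covering_space_lift_strong[OF cov \<open>x \<in> C\<close> \<open>y \<in> C\<close> assms(2,3) contp pim \<open>p x = p y\<close>[symmetric]]) blast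
  have "\<psi> (\<phi> z) = z" if "z \<in> C" for z
  proof (rule covering_space_lift_unique[OF cov _ contp pim _ _ _ _ _ _ \<open>connected C\<close> \<open>x \<in> C\<close> that])
    show "\<psi> (\<phi> x) = x" by (simp add: \<phi> \<psi>)
    show "continuous_on C (\<lambda>z. \<psi> (\<phi> z))"
      using continuous_on_compose2[OF \<psi>(1) \<phi>(1)] \<phi>(2) by blast
    show "(\<lambda>z. \<psi> (\<phi> z)) \<in> C \<rightarrow> C"
      using \<phi>(2) \<psi>(2) by auto
    show "p z = p (\<psi> (\<phi> z))" if "z \<in> C" for z
      using \<phi>(2) \<phi>(4)[OF that] \<psi>(4)[of "\<phi> z"] that by (simp add: Pi_iff)
  qed auto
  moreover have "\<phi> (\<psi> z) = z" if "z \<in> C" for z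
  proof (rule covering_space_lift_unique[OF cov _ contp pim _ _ _ _ _ _ \<open>connected C\<close> \<open>y \<in> C\<close> that])
    show "\<phi> (\<psi> y) = y" by (simp add: \<phi> \<psi>)
    show "continuous_on C (\<lambda>z. \<phi> (\<psi> z))"
      using continuous_on_compose2[OF \<phi>(1) \<psi>(1)] \<psi>(2) by blast
    show "(\<lambda>z. \<phi> (\<psi> z)) \<in> C \<rightarrow> C"
      using \<phi>(2) \<psi>(2) by auto
    show "p z = p (\<phi> (\<psi> z))" if "z \<in> C" for z
      using \<psi>(2) \<psi>(4)[OF that] \<phi>(4)[of "\<psi> z"] that by (simp add: Pi_iff)
  qed auto
  ultimately have "homeomorphism C C \<phi> \<psi>"
    using \<phi>(1,2) \<psi>(1,2) by (intro homeomorphismI) auto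
  then show ?thesis
    using that \<phi> by blast
qed

section \<open>The upper half plane and the action of the modular group\<close>

lemma upper_half_plane_properties:
  "open upper_half_plane" "simply_connected upper_half_plane" "locally path_connected upper_half_plane"
  using open_halfspace_Im_gt[of 0] convex_halfspace_Im_gt[of 0]
  by (auto simp: upper_half_plane_def convex_imp_simply_connected convex_imp_locally_path_connected)

text \<open>The derivative has absolute value \<open>Im (moebius M \<tau>) / Im \<tau>\<close>,
  which is the invariance of the Poincare metric. A zero of the denominator would force
  \<open>c = d = 0\<close>, against \<open>det M = 1\<close>.\<close>

lemma has_field_derivative_moebius:
  assumes "det M = 1" "Im \<tau> > 0"
  shows "(moebius M has_field_derivative 1 / (of_int (M$2$1) * \<tau> + of_int (M$2$2)) ^ 2) (at \<tau>)"
    and "Im (moebius M \<tau>) = Im \<tau> / norm (of_int (M$2$1) * \<tau> + of_int (M$2$2)) ^ 2"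
    and "of_int (M$2$1) * \<tau> + of_int (M$2$2) \<noteq> (0 :: complex)"
proof -
  obtain a b c d where abcd: "M$1$1 = a" "M$1$2 = b" "M$2$1 = c" "M$2$2 = d"
    by blast
  have det: "a * d - b * c = 1"
    using assms(1) by (simp add: det_2 abcd)
  then have detc: "of_int a * of_int d - of_int b * of_int c = (1 :: complex)"
    by (metis of_int_1 of_int_diff of_int_mult)
  have detr: "of_int a * of_int d - of_int b * of_int c = (1 :: real)"
    using det by (metis of_int_1 of_int_diff of_int_mult)
  show nz: "of_int (M$2$1) * \<tau> + of_int (M$2$2) \<noteq> (0 :: complex)"
  proof
    assume *: "of_int (M$2$1) * \<tau> + of_int (M$2$2) = (0 :: complex)"
    have "of_int c * Im \<tau> = 0"
      using arg_cong[OF *, of Im] by (simp add: abcd del: mult_eq_0_iff)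
    then have "c = 0"
      using assms(2) by simp
    with * have "d = 0"
      by (simp add: abcd)
    with \<open>c = 0\<close> det show False
      by simp
  qed
  have "((\<lambda>\<tau>. (of_int a * \<tau> + of_int b) / (of_int c * \<tau> + of_int d)) has_field_derivative
      (of_int a * (of_int c * \<tau> + of_int d) - (of_int a * \<tau> + of_int b) * of_int c) /
      ((of_int c * \<tau> + of_int d) * (of_int c * \<tau> + of_int d))) (at \<tau>)"
    using nz by (auto intro!: derivative_eq_intros simp: abcd)
  also have "of_int a * (of_int c * \<tau> + of_int d) - (of_int a * \<tau> + of_int b) * of_int c =
      of_int a * of_int d - of_int b * of_int c"
    by (simp add: algebra_simps)
  finally show "(moebius M has_field_derivative 1 / (of_int (M$2$1) * \<tau> + of_int (M$2$2)) ^ 2) (at \<tau>)"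
    by (simp add: detc moebius_def[abs_def] abcd power2_eq_square)
  have "Im (moebius M \<tau>) = (of_int a * of_int d - of_int b * of_int c) * Im \<tau> /
      norm (of_int c * \<tau> + of_int d) ^ 2"
    by (simp add: moebius_def abcd Im_divide cmod_power2 algebra_simps)
  then show "Im (moebius M \<tau>) = Im \<tau> / norm (of_int (M$2$1) * \<tau> + of_int (M$2$2)) ^ 2"
    by (simp add: detr abcd)
qed

text \<open>If \<open>c \<noteq> 0\<close>, then
  \<open>norm (c * \<tau> + d) \<ge> Im \<tau>\<close>, and the image has imaginary part at most 1.
  Hence \<open>c = 0\<close>, and \<open>M\<close> is a translation by a multiple of
  \<open>N\<close>, which leaves the nome unchanged.\<close>

lemma nome_eq_of_high:
  assumes "M \<in> congruence_matrices N" "0 < N" "Im \<tau> > 1" "Im (moebius M \<tau>) > 1"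
  shows "nome N (moebius M \<tau>) = nome N \<tau>"
proof -
  obtain a b c d where abcd: "M$1$1 = a" "M$1$2 = b" "M$2$1 = c" "M$2$2 = d"
    by blast
  have "det M = 1"
    using assms(1) by (simp add: congruence_matrices_def)
  then have det: "a * d - b * c = 1"
    by (simp add: det_2 abcd)
  \<comment> \<open>Either sign of the identity matrix has off-diagonal entry 0, so both cases give
    the same divisibility.\<close>
  have b: "int N dvd b"
  proof -
    have "[M$1$2 = (mat 1 :: int^2^2)$1$2] (mod int N) \<or> [M$1$2 = - ((mat 1 :: int^2^2)$1$2)] (mod int N)"
      using assms(1) unfolding congruence_matrices_def by blast
    moreover have "(1 :: 2) \<noteq> 2"
      by simp
    ultimately show ?thesis
      by (auto simp: mat_def abcd cong_0_iff)
  qed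
  have "c = 0"
  proof (rule ccontr)
    assume "c \<noteq> 0"
    have "\<bar>of_int c * Im \<tau>\<bar> \<le> norm (of_int c * \<tau> + of_int d)"
      using abs_Im_le_cmod[of "of_int c * \<tau> + of_int d"] by simp
    moreover have "Im \<tau> \<le> \<bar>of_int c * Im \<tau>\<bar>"
    proof -
      have "1 \<le> \<bar>real_of_int c\<bar>"
        using \<open>c \<noteq> 0\<close> by linarith
      then show ?thesis
        using assms(3) by (simp add: abs_mult)
    qed
    ultimately have "Im \<tau> \<le> norm (of_int c * \<tau> + of_int d)"
      by simp
    then have "Im \<tau> ^ 2 \<le> norm (of_int c * \<tau> + of_int d) ^ 2"
      using assms(3) by (intro power_mono) auto
    moreover have "Im \<tau> \<le> Im \<tau> ^ 2"
      using assms(3) by (simp add: power2_eq_square)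
    ultimately have "Im \<tau> \<le> norm (of_int c * \<tau> + of_int d) ^ 2"
      by simp
    then have "Im (moebius M \<tau>) \<le> 1"
      using has_field_derivative_moebius(2)[OF \<open>det M = 1\<close>, of \<tau>] assms(3)
      by (simp add: abcd divide_le_eq_1)
    with assms(4) show False
      by simp
  qed
  then have ad: "a * d = 1"
    using det by simp
  then have "a = 1 \<and> d = 1 \<or> a = -1 \<and> d = -1"
    by (simp add: zmult_eq_1_iff)
  then have "moebius M \<tau> = \<tau> + of_int (a * b)"
    using \<open>c = 0\<close> by (auto simp: moebius_def abcd)
  moreover obtain k where "b = int N * k"
    using b by blast
  ultimately have "moebius M \<tau> = \<tau> + of_nat N * of_int (a * k)"
    by simp
  then have "nome N (moebius M \<tau>) = exp (2 * of_real pi / of_nat N * \<i> * \<tau> + 2 * of_int (a * k) * of_real pi * \<i>)"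
    using \<open>0 < N\<close> by (simp add: nome_def field_simps)
  also have "\<dots> = nome N \<tau>"
    using exp_plus_2pin[of _ "a * k"] by (simp add: nome_def exp_add exp_integer_2pi mult_ac)
  finally show ?thesis .
qed

section \<open>The coordinate at the cusp\<close>

lemma norm_nome: "norm (nome N \<tau>) = exp (- (2 * pi / of_nat N * Im \<tau>))"
proof -
  define r where "r = 2 * pi / of_nat N"
  have "2 * of_real pi / of_nat N * \<i> * \<tau> = of_real r * (\<i> * \<tau>)"
    by (simp add: r_def)
  then have "nome N \<tau> = exp (of_real r * (\<i> * \<tau>))"
    by (simp only: nome_def)
  then show ?thesis
    by (simp add: norm_exp_eq_Re flip: r_def)
qed

lemma nome_nonzero [simp]: "nome N \<tau> \<noteq> 0"
  by (simp add: nome_def)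

lemma nome_surj:
  assumes "0 < N" "q \<noteq> 0"
  obtains \<tau> where "nome N \<tau> = q"
proof
  show "nome N (of_nat N * Ln q / (2 * of_real pi * \<i>)) = q"
    using assms by (simp add: nome_def)
qed

lemma Im_gt_iff_norm_nome:
  assumes "0 < N"
  shows "Im \<tau> > Y \<longleftrightarrow> norm (nome N \<tau>) < exp (- (2 * pi / of_nat N * Y))"
  using assms by (simp add: norm_nome divide_less_cancel)

lemma has_field_derivative_nome:
  assumes "0 < N"
  shows "(nome N has_field_derivative 2 * of_real pi / of_nat N * \<i> * nome N \<tau>) (at \<tau>)"
  unfolding nome_def using assms by (auto intro!: derivative_eq_intros)

text \<open>The function \<open>\<Phi>\<close> is \<open>log (q / w)\<close> as a function of \<open>w = f / A\<close> near the cusp.\<close>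

definition cusp_log :: "nat \<Rightarrow> (complex \<Rightarrow> cp1) \<Rightarrow> complex \<Rightarrow> (complex \<Rightarrow> complex) \<Rightarrow> bool" where
  "cusp_log N f A \<Phi> \<longleftrightarrow> \<Phi> analytic_on {0} \<and> \<Phi> 0 = 0 \<and>
     (\<forall>Y. \<forall>\<^sub>F w in at 0. \<exists>\<tau>. Im \<tau> > Y \<and> nome N \<tau> = w * exp (\<Phi> w) \<and> f \<tau> = Aff (A * w)) \<and>
     (\<forall>\<epsilon>>0. \<exists>Y. \<forall>\<tau>. Im \<tau> > Y \<longrightarrow>
        (\<exists>w. w \<noteq> 0 \<and> norm w < \<epsilon> \<and> nome N \<tau> = w * exp (\<Phi> w) \<and> f \<tau> = Aff (A * w)))"

section \<open>Coverings whose deck group is the congruence group, and their fibres\<close>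

locale cusp_cover =
  fixes N n :: nat and a :: "nat \<Rightarrow> cp1" and f :: "complex \<Rightarrow> cp1" and A B :: complex
  assumes N: "0 < N" and n: "1 \<le> n" and a1: "a 1 = Aff 0"
    and cov: "covering_space upper_half_plane f (UNIV - a ` {1..n})"
    and hol: "cp1_holomorphic_on f upper_half_plane"
    and deck: "deck_group f = principal_congruence_group N"
    and expansion: "has_q_expansion N f A B"
begin

text \<open>This is \<open>1/f\<close>, finite throughout the upper half plane because
  \<open>f\<close> omits 0.\<close>

definition G :: "complex \<Rightarrow> complex" where "G = aff_inf \<circ> f"

text \<open>The finite punctures of \<open>G\<close>. The point \<open>Aff 0\<close> is removed
  first, since \<open>aff_inf\<close> would send it to the default value 0, which is the image of
  \<open>Infty\<close>.\<close>

definition E :: "complex set" where "E = aff_inf ` (a ` {1..n} - {Aff 0})"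

lemma finite_E: "finite E"
  by (simp add: E_def)

lemma a1_in: "Aff 0 \<in> a ` {1..n}"
  using n a1 by (intro image_eqI[of _ _ 1]) auto

lemma f_nonzero:
  assumes "\<tau> \<in> upper_half_plane"
  shows "f \<tau> \<noteq> Aff 0"
proof
  assume "f \<tau> = Aff 0"
  moreover have "f \<tau> \<in> UNIV - a ` {1..n}"
    using assms covering_space_imp_surjective[OF cov] by (metis imageI)
  ultimately show False
    using a1_in by simp
qed

lemma f_eq_of_inf: "\<tau> \<in> upper_half_plane \<Longrightarrow> f \<tau> = of_inf (G \<tau>)"
  by (simp add: G_def of_inf_aff_inf f_nonzero)

lemma f_eq_iff_G_eq:
  assumes "\<tau> \<in> upper_half_plane" "\<tau>' \<in> upper_half_plane"
  shows "f \<tau> = f \<tau>' \<longleftrightarrow> G \<tau> = G \<tau>'"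
  using assms[THEN f_eq_of_inf] by (auto simp: G_def)

lemma covering_G: "covering_space upper_half_plane G (- E)"
  unfolding G_def
proof (rule covering_space_homeomorphism_compose[OF cov])
  show "homeomorphism (UNIV - a ` {1..n}) (- E) aff_inf of_inf"
  proof (rule homeomorphism_of_subsets[OF homeomorphism_aff_inf])
    show "aff_inf ` (UNIV - a ` {1..n}) = - E"
    proof
      show "aff_inf ` (UNIV - a ` {1..n}) \<subseteq> - E"
      proof
        fix w assume "w \<in> aff_inf ` (UNIV - a ` {1..n})"
        then obtain x where x: "x \<notin> a ` {1..n}" "w = aff_inf x"
          by blast
        show "w \<in> - E"
        proof
          assume "w \<in> E"
          then obtain y where y: "y \<in> a ` {1..n}" "y \<noteq> Aff 0" "w = aff_inf y"
            by (auto simp: E_def)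
          have "x \<noteq> Aff 0"
            using a1_in x by metis
          then have "x = y"
            using x(2) y(2,3) of_inf_aff_inf by metis
          with x(1) y(1) show False
            by simp
        qed
      qed
      show "- E \<subseteq> aff_inf ` (UNIV - a ` {1..n})"
      proof
        fix w assume "w \<in> - E"
        have "of_inf w \<notin> a ` {1..n}"
        proof
          assume "of_inf w \<in> a ` {1..n}"
          then have "aff_inf (of_inf w) \<in> E"
            unfolding E_def by (intro imageI) auto
          with \<open>w \<in> - E\<close> show False
            by simp
        qed
        then show "w \<in> aff_inf ` (UNIV - a ` {1..n})"
          by (intro image_eqI[of _ _ "of_inf w"]) auto
      qed
    qed
  qed (use a1_in in auto)
qed

lemma holomorphic_G: "G holomorphic_on upper_half_plane"
proof -
  have "G analytic_on {\<tau>}" if "\<tau> \<in> upper_half_plane" for \<tau>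
    using hol that f_nonzero by (auto simp: cp1_holomorphic_on_def G_def)
  then have "G analytic_on upper_half_plane"
    using analytic_on_analytic_at by blast
  then show ?thesis
    by (rule analytic_imp_holomorphic)
qed

text \<open>Deck transformations act transitively on the fibres because the upper half plane is
  simply connected. So the fibres are the orbits of the congruence group and depend on
  \<open>N\<close> alone.\<close>

lemma f_eq_iff:
  assumes "\<tau> \<in> upper_half_plane" "\<tau>' \<in> upper_half_plane"
  shows "f \<tau> = f \<tau>' \<longleftrightarrow> (\<exists>M\<in>congruence_matrices N. \<tau>' = moebius M \<tau>)"
proof
  assume "f \<tau> = f \<tau>'"
  then have "G \<tau> = G \<tau>'"
    by (simp add: G_def)
  obtain \<phi> \<psi> where \<phi>: "homeomorphism upper_half_plane upper_half_plane \<phi> \<psi>" "\<phi> \<tau> = \<tau>'"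
      "\<And>z. z \<in> upper_half_plane \<Longrightarrow> G (\<phi> z) = G z"
    by (rule covering_space_deck_transitive[OF covering_G upper_half_plane_properties(2,3) assms
        \<open>G \<tau> = G \<tau>'\<close>]) blast
  let ?\<phi> = "restrict \<phi> upper_half_plane"
  have "homeomorphism upper_half_plane upper_half_plane ?\<phi> \<psi>"
    by (rule homeomorphism_cong[OF \<phi>(1)]) auto
  moreover have "f (?\<phi> z) = f z" if "z \<in> upper_half_plane" for z
  proof -
    have "\<phi> z \<in> upper_half_plane"
      using \<phi>(1) that by (auto simp: homeomorphism_def)
    then show ?thesis
      using \<phi>(3)[OF that] that f_eq_iff_G_eq[of "\<phi> z" z] by simp
  qed
  ultimately have "?\<phi> \<in> principal_congruence_group N"
    unfolding deck[symmetric] deck_group_def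
    by (intro CollectI conjI exI[of _ \<psi>] ballI) (auto intro: restrict_extensional)
  then obtain M where M: "M \<in> congruence_matrices N" "?\<phi> = restrict (moebius M) upper_half_plane"
    by (auto simp: principal_congruence_group_def)
  have "?\<phi> \<tau> = restrict (moebius M) upper_half_plane \<tau>"
    by (simp only: M(2))
  then have "\<tau>' = moebius M \<tau>"
    using \<phi>(2) assms(1) by simp
  with M(1) show "\<exists>M\<in>congruence_matrices N. \<tau>' = moebius M \<tau>"
    by blast
next
  assume "\<exists>M\<in>congruence_matrices N. \<tau>' = moebius M \<tau>"
  then obtain M where M: "M \<in> congruence_matrices N" "\<tau>' = moebius M \<tau>"
    by blast
  then have "restrict (moebius M) upper_half_plane \<in> deck_group f"
    unfolding deck principal_congruence_group_def by blast
  then show "f \<tau> = f \<tau>'"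
    using assms(1) M(2) by (auto simp: deck_group_def)
qed

text \<open>Above height 1 the nome is thus a function of \<open>f\<close>; this yields the
  injectivity of the \<open>q\<close>-series.\<close>

lemma nome_eq_of_f_eq:
  assumes "f \<tau> = f \<tau>'" "Im \<tau> > 1" "Im \<tau>' > 1"
  shows "nome N \<tau> = nome N \<tau>'"
proof -
  have "\<tau> \<in> upper_half_plane" "\<tau>' \<in> upper_half_plane"
    using assms by (auto simp: upper_half_plane_def)
  with assms(1) have "\<exists>M\<in>congruence_matrices N. \<tau>' = moebius M \<tau>"
    by (simp add: f_eq_iff)
  then obtain M where "M \<in> congruence_matrices N" "\<tau>' = moebius M \<tau>" ..
  then show ?thesis
    using nome_eq_of_high[of M N \<tau>] N assms by simp
qed

end

section \<open>The \<open>q\<close>-series at the cusp and its inverse\<close>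

context cusp_cover begin

text \<open>\<open>r\<close> is the radius of the disc of nomes that corresponds to the height
  \<open>Y\<close>; \<open>1 \<le> Y\<close> keeps it in the range where \<open>f\<close> determines
  the nome.\<close>

definition is_cusp_series :: "real \<Rightarrow> real \<Rightarrow> complex fps \<Rightarrow> bool" where
  "is_cusp_series r Y C \<longleftrightarrow> 0 < r \<and> 1 \<le> Y \<and> fps_nth C 0 = 0 \<and> fps_nth C 1 = A \<and> fps_nth C 2 = B \<and>
     r \<le> fps_conv_radius C \<and> inj_on (eval_fps C) (ball 0 r) \<and>
     (\<forall>\<tau>. Im \<tau> > Y \<longleftrightarrow> norm (nome N \<tau>) < r) \<and>
     (\<forall>\<tau>. Im \<tau> > Y \<longrightarrow> f \<tau> = Aff (eval_fps C (nome N \<tau>)))"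

text \<open>Injectivity on the punctured disc comes from \<open>nome_eq_of_f_eq\<close>; the centre
  is separated from the other points because \<open>f\<close> omits 0.\<close>

lemma ex_cusp_series: "\<exists>r Y C. is_cusp_series r Y C"
proof -
  obtain c Y0 where c: "c 0 = 0" "c 1 = A" "c 2 = B"
      and Y0: "\<And>\<tau>. Im \<tau> > Y0 \<Longrightarrow> f \<tau> \<noteq> Infty \<and> (\<lambda>k. c k * nome N \<tau> ^ k) sums aff (f \<tau>)"
    using expansion by (auto simp: has_q_expansion_def)
  define Y where "Y = max 1 Y0"
  define r where "r = exp (- (2 * pi / of_nat N * Y))"
  define C where "C = Abs_fps c"
  have iff: "Im \<tau> > Y \<longleftrightarrow> norm (nome N \<tau>) < r" for \<tau>
    unfolding r_def by (rule Im_gt_iff_norm_nome[OF N])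
  have sums: "(\<lambda>k. fps_nth C k * nome N \<tau> ^ k) sums aff (f \<tau>)" and fin: "f \<tau> \<noteq> Infty" if "Im \<tau> > Y" for \<tau>
    using Y0[of \<tau>] that by (auto simp: Y_def C_def)
  \<comment> \<open>Each real \<open>s\<close> between 0 and \<open>r\<close> is the nome of a point
    above \<open>Y\<close>, so the series converges at \<open>s\<close>.\<close>
  have radius: "r \<le> fps_conv_radius C"
    unfolding fps_conv_radius_def
  proof (rule conv_radius_geI_ex)
    fix s :: real assume s: "0 < s" "ereal s < ereal r"
    obtain \<tau> where \<tau>: "nome N \<tau> = of_real s"
      using nome_surj[OF N, of "of_real s"] s by auto
    then have "summable (\<lambda>k. fps_nth C k * of_real s ^ k)"
      using sums[of \<tau>] iff[of \<tau>] s by (auto simp: sums_iff)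
    then show "\<exists>z. norm z = s \<and> summable (\<lambda>n. fps_nth C n * z ^ n)"
      using s by (intro exI[of _ "of_real s"]) auto
  qed
  have f: "f \<tau> = Aff (eval_fps C (nome N \<tau>))" if "Im \<tau> > Y" for \<tau>
  proof -
    have "ereal (norm (nome N \<tau>)) < fps_conv_radius C"
      using iff[of \<tau>] that radius less_le_trans[of "ereal (norm (nome N \<tau>))" "ereal r"] by simp
    then have "aff (f \<tau>) = eval_fps C (nome N \<tau>)"
      using sums_eval_fps sums_unique2 sums[OF that] by blast
    then show ?thesis
      using fin[OF that] by (cases "f \<tau>") auto
  qed
  have nz: "eval_fps C q \<noteq> 0" if q: "norm q < r" "q \<noteq> 0" for q
  proof
    assume *: "eval_fps C q = 0"
    obtain \<tau> where \<tau>: "nome N \<tau> = q"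
      by (rule nome_surj[OF N q(2)])
    then have "Im \<tau> > Y"
      using iff q by simp
    then have "f \<tau> = Aff 0" "\<tau> \<in> upper_half_plane"
      using f[of \<tau>] * \<tau> by (auto simp: upper_half_plane_def Y_def)
    then show False
      using f_nonzero by blast
  qed
  have C0: "eval_fps C 0 = 0"
    by (simp add: eval_fps_at_0 C_def c)
  have "inj_on (eval_fps C) (ball 0 r)"
  proof (rule inj_onI)
    fix p q assume pq: "p \<in> ball 0 r" "q \<in> ball 0 r" "eval_fps C p = eval_fps C q"
    show "p = q"
    proof (cases "p = 0 \<or> q = 0")
      case True
      have "norm p < r" "norm q < r"
        using pq by auto
      then show ?thesis
        using True nz[of p] nz[of q] C0 pq(3) by metis
    next
      case False
      obtain \<tau> where \<tau>: "nome N \<tau> = p"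
        using nome_surj[OF N, of p] False by blast
      obtain \<tau>' where \<tau>': "nome N \<tau>' = q"
        using nome_surj[OF N, of q] False by blast
      have Im: "Im \<tau> > Y" "Im \<tau>' > Y"
        using pq \<tau> \<tau>' iff by auto
      then have "f \<tau> = f \<tau>'"
        using f \<tau> \<tau>' pq by simp
      then have "nome N \<tau> = nome N \<tau>'"
        by (rule nome_eq_of_f_eq) (use Im in \<open>auto simp: Y_def\<close>)
      then show ?thesis
        using \<tau> \<tau>' by simp
    qed
  qed
  moreover have "0 < r" "1 \<le> Y" "fps_nth C 0 = 0" "fps_nth C 1 = A" "fps_nth C 2 = B"
    by (auto simp: r_def Y_def C_def c c(2)[unfolded One_nat_def])
  ultimately have "is_cusp_series r Y C"
    unfolding is_cusp_series_def using radius iff f by (intro conjI allI impI)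
  then show ?thesis
    by blast
qed

text \<open>An injective holomorphic function has nonzero derivative, so
  \<open>A \<noteq> 0\<close>, and \<open>h = f/A\<close>, as a function of \<open>q\<close>, has a
  holomorphic inverse \<open>g\<close>. Then \<open>\<Phi> w\<close> is minus the logarithm of
  \<open>h q / q\<close> at \<open>q = g w\<close>. Its derivative at 0 is \<open>- (B / A)\<close>
  because \<open>h q / q\<close> has linear coefficient \<open>B / A\<close> and \<open>g\<close>
  has derivative 1.\<close>

lemma ex_cusp_log:
  obtains \<Phi> where "cusp_log N f A \<Phi>" "(\<Phi> has_field_derivative - (B / A)) (at 0)" "A \<noteq> 0"
proof -
  obtain r Y C where "is_cusp_series r Y C"
    using ex_cusp_series by blast
  note series = this[unfolded is_cusp_series_def]
  have r: "0 < r" "1 \<le> Y" and C: "fps_nth C 0 = 0" "fps_nth C 1 = A" "fps_nth C 2 = B"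
    and radius: "r \<le> fps_conv_radius C" and inj: "inj_on (eval_fps C) (ball 0 r)"
    using series by blast+
  have iff: "Im \<tau> > Y \<longleftrightarrow> norm (nome N \<tau>) < r" for \<tau>
    using series by (elim conjE) (rule spec)
  have "\<forall>\<tau>. Im \<tau> > Y \<longrightarrow> f \<tau> = Aff (eval_fps C (nome N \<tau>))"
    using series by (elim conjE)
  then have f: "f \<tau> = Aff (eval_fps C (nome N \<tau>))" if "Im \<tau> > Y" for \<tau>
    using that by blast
  have small: "ereal (norm q) < fps_conv_radius C" if "norm q < r" for q :: complex
    using that less_le_trans[OF _ radius, of "ereal (norm q)"] by simp
  have rad: "ereal 0 < fps_conv_radius C"
    using small[of 0] r(1) by simp
  have hol: "eval_fps C holomorphic_on ball 0 r"
    using radius by (intro holomorphic_on_eval_fps) (auto intro: small)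
  have C0: "eval_fps C 0 = 0"
    by (simp add: eval_fps_at_0 C)
  have C': "(eval_fps C has_field_derivative A) (at 0)"
    using has_field_derivative_eval_fps[of 0 C UNIV] rad by (simp add: eval_fps_at_0 C[unfolded One_nat_def])
  then have "deriv (eval_fps C) 0 = A"
    by (rule DERIV_imp_deriv)
  then have A: "A \<noteq> 0"
    using holomorphic_injective_imp_regular[OF hol _ inj, of 0] r by simp
  define h where "h q = eval_fps C q / A" for q
  have h: "h holomorphic_on ball 0 r"
    unfolding h_def using A by (intro holomorphic_on_divide hol holomorphic_on_const) auto
  have inj_h: "inj_on h (ball 0 r)"
    using inj A by (simp add: h_def inj_on_def)
  have h0: "h 0 = 0"
    by (simp add: h_def C0)
  have h': "(h has_field_derivative 1) (at 0)"
    unfolding h_def using DERIV_cdivide[OF C', of A] A by simp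
  obtain g where g: "g holomorphic_on (h ` ball 0 r)"
      "\<And>q. q \<in> ball 0 r \<Longrightarrow> deriv h q * deriv g (h q) = 1"
      "\<And>q. q \<in> ball 0 r \<Longrightarrow> g (h q) = q"
    by (rule holomorphic_has_inverse[OF h open_ball inj_h]) blast
  have open_im: "open (h ` ball 0 r)"
    by (rule open_mapping_thm3[OF h open_ball inj_h])
  have im0: "0 \<in> h ` ball 0 r"
    using h0 r by force
  have g0: "g 0 = 0"
    using g(3)[of 0] h0 r by simp
  have g': "(g has_field_derivative 1) (at 0)"
  proof -
    have "deriv h 0 = 1"
      using h' by (rule DERIV_imp_deriv)
    then have "deriv g 0 = 1"
      using g(2)[of 0] h0 r by simp
    then show ?thesis
      using holomorphic_derivI[OF g(1) open_im im0] by simp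
  qed
  have ana_g: "g analytic_on {0}"
    using g(1) open_im im0 analytic_at by blast
  \<comment> \<open>Shifting the series gives \<open>h q / q\<close> with the value 1 at the
    removable singularity.\<close>
  define v where "v q = eval_fps (fps_shift 1 C) q / A" for q
  have "C \<noteq> 0"
    using C(2) A by auto
  then have "1 \<le> subdegree C"
    by (intro subdegree_geI) (use C(1) in auto)
  then have v_eq: "v q = (if q = 0 then 1 else h q / q)" if "norm q < r" for q
    using eval_fps_shift[of 1 C q] small[OF that] C A
    by (auto simp: v_def h_def)
  have v0: "v 0 = 1"
    using v_eq[of 0] r by simp
  have v': "(v has_field_derivative B / A) (at 0)"
    unfolding v_def using has_field_derivative_eval_fps[of 0 "fps_shift 1 C" UNIV] rad A
    by (intro DERIV_cdivide) (simp add: eval_fps_at_0 C numeral_2_eq_2[symmetric])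
  have ana_v: "v analytic_on {0}"
    unfolding v_def using rad A by (intro analytic_intros analytic_on_eval_fps) auto
  define \<Phi> where "\<Phi> w = - Ln (v (g w))" for w
  have deriv: "(\<Phi> has_field_derivative - (B / A)) (at 0)"
  proof -
    have "((\<lambda>w. v (g w)) has_field_derivative B / A * 1) (at 0)"
      by (rule DERIV_chain2[OF _ g']) (simp add: g0 v')
    moreover have "(Ln has_field_derivative 1) (at (v (g 0)))"
      using has_field_derivative_Ln[of 1] by (simp add: g0 v0)
    ultimately have "((\<lambda>w. Ln (v (g w))) has_field_derivative 1 * (B / A * 1)) (at 0)"
      by (intro DERIV_chain2[of Ln 1 "\<lambda>w. v (g w)"])
    then show ?thesis
      unfolding \<Phi>_def by (auto intro: DERIV_minus)
  qed
  have \<Phi>0: "\<Phi> 0 = 0"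
    by (simp add: \<Phi>_def g0 v0)
  have "(\<lambda>w. v (g w)) analytic_on {0}"
    using analytic_on_compose[OF ana_g, of v] ana_v by (simp add: o_def g0)
  then have ana: "\<Phi> analytic_on {0}"
    unfolding \<Phi>_def by (intro analytic_intros) (auto simp: g0 v0)
  have exp: "q = h q * exp (\<Phi> (h q))" if q: "norm q < r" "q \<noteq> 0" for q
  proof -
    have "h q \<noteq> 0"
      using inj_onD[OF inj_h, of q 0] h0 q r by auto
    then have "v q \<noteq> 0"
      using v_eq q by simp
    then have "exp (\<Phi> (h q)) = 1 / v q"
      using g(3)[of q] q by (simp add: \<Phi>_def exp_minus divide_inverse)
    then show ?thesis
      using v_eq q \<open>h q \<noteq> 0\<close> by simp
  qed
  have down: "h (nome N \<tau>) \<noteq> 0 \<and> nome N \<tau> = h (nome N \<tau>) * exp (\<Phi> (h (nome N \<tau>)))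
      \<and> f \<tau> = Aff (A * h (nome N \<tau>))" if "Im \<tau> > Y" for \<tau>
    using exp[of "nome N \<tau>"] f[OF that] iff[of \<tau>] that A
    by (auto simp: h_def)
  have "cusp_log N f A \<Phi>"
    unfolding cusp_log_def
  proof (intro conjI allI impI ana \<Phi>0)
    fix Z :: real
    have "isCont g 0"
      using g' by (rule DERIV_isCont)
    then have "((\<lambda>w. norm (g w)) \<longlongrightarrow> 0) (at 0)"
      using g0 by (auto simp: isCont_def tendsto_norm_zero_iff)
    then have "\<forall>\<^sub>F w in at 0. norm (g w) < min r (exp (- (2 * pi / of_nat N * Z)))"
      by (rule order_tendstoD) (use r in auto)
    moreover have "\<forall>\<^sub>F w in at 0. w \<in> h ` ball 0 r"
      using open_im im0 by (rule eventually_at_in_open')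
    ultimately show "\<forall>\<^sub>F w in at 0. \<exists>\<tau>. Im \<tau> > Z \<and> nome N \<tau> = w * exp (\<Phi> w) \<and> f \<tau> = Aff (A * w)"
      using eventually_neq_at_within[of 0]
    proof eventually_elim
      case (elim w)
      then obtain q where q: "q \<in> ball 0 r" "w = h q"
        by blast
      then have gw: "g w = q"
        using g(3) by simp
      have "q \<noteq> 0"
        using elim(3) q(2) h0 by auto
      obtain \<tau> where \<tau>: "nome N \<tau> = q"
        by (rule nome_surj[OF N \<open>q \<noteq> 0\<close>])
      have "Im \<tau> > Y" "Im \<tau> > Z"
        using elim(1) iff[of \<tau>] Im_gt_iff_norm_nome[OF N, of Z \<tau>] gw \<tau> by auto
      then show ?case
        using down[of \<tau>] q \<tau> by (intro exI[of _ \<tau>]) simp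
    qed
  next
    fix \<epsilon> :: real assume "0 < \<epsilon>"
    have "isCont h 0"
      using h' by (rule DERIV_isCont)
    from this[unfolded continuous_at_eps_delta, rule_format, OF \<open>0 < \<epsilon>\<close>]
    obtain d where d: "0 < d" "\<forall>q. norm q < d \<longrightarrow> norm (h q) < \<epsilon>"
      unfolding h0 dist_norm diff_zero by (elim exE conjE)
    define Z where "Z = - ln d * of_nat N / (2 * pi)"
    have "2 * pi / of_nat N * Z = - ln d"
      unfolding Z_def using N by simp
    then have exp_Z: "exp (- (2 * pi / of_nat N * Z)) = d"
      using d(1) by simp
    have less_d: "Im \<tau> > Z \<longleftrightarrow> norm (nome N \<tau>) < d" for \<tau>
      by (simp only: Im_gt_iff_norm_nome[OF N, of Z \<tau>] exp_Z)
    show "\<exists>Y. \<forall>\<tau>. Im \<tau> > Y \<longrightarrow>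
        (\<exists>w. w \<noteq> 0 \<and> norm w < \<epsilon> \<and> nome N \<tau> = w * exp (\<Phi> w) \<and> f \<tau> = Aff (A * w))"
    proof (intro exI[of _ "max Y Z"] allI impI)
      fix \<tau> assume "Im \<tau> > max Y Z"
      then show "\<exists>w. w \<noteq> 0 \<and> norm w < \<epsilon> \<and> nome N \<tau> = w * exp (\<Phi> w) \<and> f \<tau> = Aff (A * w)"
        using down[of \<tau>] d less_d[of \<tau>] by (intro exI[of _ "h (nome N \<tau>)"]) auto
    qed
  qed
  then show ?thesis
    using that deriv A by blast
qed

end

section \<open>The induced density\<close>

lemma eventually_at_norm_less: "0 < e \<Longrightarrow> \<forall>\<^sub>F w in at (0 :: 'a :: real_normed_vector). norm w < e"
  unfolding eventually_at by (auto intro!: exI[of _ e])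

context cusp_cover begin

lemma has_field_derivative_aff_f:
  assumes "\<tau> \<in> upper_half_plane" "f \<tau> \<noteq> Infty"
  shows "(aff \<circ> f has_field_derivative deriv (aff \<circ> f) \<tau>) (at \<tau>)"
proof -
  have "(aff \<circ> f) analytic_on {\<tau>}"
    using hol assms by (auto simp: cp1_holomorphic_on_def)
  then show ?thesis
    using analytic_on_imp_differentiable_at field_differentiable_derivI by blast
qed

text \<open>Points of one fibre are related by some \<open>moebius M\<close>. The chain rule
  contributes \<open>1 / j ^ 2\<close>, with \<open>j\<close> the denominator, and the imaginary
  part changes by its absolute value. So the number required by \<open>induced_density\<close> is
  the same at all points of the fibre.\<close>

lemma norm_deriv_times_Im_eq:
  assumes "\<tau> \<in> upper_half_plane" "\<tau>' \<in> upper_half_plane" "f \<tau> = f \<tau>'" "f \<tau> \<noteq> Infty"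
  shows "norm (deriv (aff \<circ> f) \<tau>) * Im \<tau> = norm (deriv (aff \<circ> f) \<tau>') * Im \<tau>'"
proof -
  let ?g = "aff \<circ> f"
  have "\<exists>M\<in>congruence_matrices N. \<tau>' = moebius M \<tau>"
    using f_eq_iff[OF assms(1,2)] assms(3) by simp
  then obtain M where M: "M \<in> congruence_matrices N" "\<tau>' = moebius M \<tau>" ..
  have det: "det M = 1"
    using M(1) by (simp add: congruence_matrices_def)
  define j where "j = of_int (M$2$1) * \<tau> + of_int (M$2$2)"
  have Im: "0 < Im \<tau>"
    using assms(1) by (simp add: upper_half_plane_def)
  note mob = has_field_derivative_moebius[OF det Im, folded j_def]
  have inv: "?g (moebius M z) = ?g z" if z: "z \<in> upper_half_plane" for z
  proof -
    have "0 < Im z"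
      using z by (simp add: upper_half_plane_def)
    then have "moebius M z \<in> upper_half_plane"
      using has_field_derivative_moebius(2,3)[OF det, of z] by (simp add: upper_half_plane_def)
    then have "f z = f (moebius M z)"
      using f_eq_iff[OF z] M(1) by blast
    then show ?thesis
      by simp
  qed
  have "(?g has_field_derivative deriv ?g \<tau>') (at (moebius M \<tau>))"
    using has_field_derivative_aff_f[OF assms(2)] assms(3,4) by (simp add: M(2))
  then have "((\<lambda>z. ?g (moebius M z)) has_field_derivative deriv ?g \<tau>' * (1 / j ^ 2)) (at \<tau>)"
    by (rule DERIV_chain2[OF _ mob(1)])
  then have "(?g has_field_derivative deriv ?g \<tau>' * (1 / j ^ 2)) (at \<tau>)"
    by (rule has_field_derivative_transform_within_open[OF _ upper_half_plane_properties(1) assms(1) inv])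
  then have "deriv ?g \<tau> = deriv ?g \<tau>' * (1 / j ^ 2)"
    by (rule DERIV_imp_deriv)
  then show ?thesis
    using mob(2) by (simp add: M(2) norm_mult norm_divide norm_power)
qed

text \<open>Differentiating \<open>q = u * exp (\<Phi> u)\<close> for \<open>u = f/A\<close> gives
  \<open>u' * (1 + w * deriv \<Phi> w) = 2 pi i / N * w\<close>. The logarithm of
  \<open>norm q\<close> gives \<open>ln (norm w) + Re (\<Phi> w) = - (2 pi / N * Im \<tau>)\<close>.
  The factor \<open>2 pi / N\<close> cancels in the quotient.\<close>

lemma eventually_induced_density:
  assumes log: "cusp_log N f A \<Phi>" and A: "A \<noteq> 0"
  shows "\<forall>\<^sub>F w in at 0. induced_density f (A * w) =
    norm (1 + w * deriv \<Phi> w) / (norm (A * w) * \<bar>ln (norm w) + Re (\<Phi> w)\<bar>)"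
proof -
  have "\<Phi> analytic_on {0}"
    using log by (simp add: cusp_log_def)
  then obtain e where e: "0 < e" "\<Phi> holomorphic_on ball 0 e"
    by (auto simp: analytic_on_def)
  obtain Y0 where Y0: "\<forall>\<tau>. Im \<tau> > Y0 \<longrightarrow>
      (\<exists>w. w \<noteq> 0 \<and> norm w < e \<and> nome N \<tau> = w * exp (\<Phi> w) \<and> f \<tau> = Aff (A * w))"
    using log e(1) unfolding cusp_log_def by blast
  define Y where "Y = max 1 Y0"
  let ?g = "aff \<circ> f"
  define u where "u \<tau> = ?g \<tau> / A" for \<tau>
  have u: "u \<tau> * exp (\<Phi> (u \<tau>)) = nome N \<tau>" if \<tau>: "Im \<tau> > Y" for \<tau>
  proof -
    obtain w where "nome N \<tau> = w * exp (\<Phi> w)" "f \<tau> = Aff (A * w)"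
      using Y0[rule_format, of \<tau>] \<tau> unfolding Y_def by auto
    then show ?thesis
      using A by (simp add: u_def)
  qed
  have "\<forall>\<^sub>F w in at 0. \<exists>\<tau>. Im \<tau> > Y \<and> nome N \<tau> = w * exp (\<Phi> w) \<and> f \<tau> = Aff (A * w)"
    using log by (simp add: cusp_log_def)
  then show ?thesis
    using eventually_at_norm_less[OF e(1)] eventually_neq_at_within[of 0]
  proof eventually_elim
    case (elim w)
    then obtain \<tau> where \<tau>: "Im \<tau> > Y" "nome N \<tau> = w * exp (\<Phi> w)" "f \<tau> = Aff (A * w)"
      by blast
    have H: "\<tau> \<in> upper_half_plane" and Im: "Im \<tau> > 0"
      using \<tau>(1) by (auto simp: upper_half_plane_def Y_def)
    have uw: "u \<tau> = w"
      using \<tau>(3) A by (simp add: u_def)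
    define u' where "u' = deriv ?g \<tau> / A"
    have du: "(u has_field_derivative u') (at \<tau>)"
      unfolding u_def u'_def using has_field_derivative_aff_f[OF H] \<tau>(3) unfolding o_def by (intro DERIV_cdivide) auto
    have d\<Phi>: "(\<Phi> has_field_derivative deriv \<Phi> w) (at (u \<tau>))"
      unfolding uw using elim(2) e(2) by (intro holomorphic_derivI[OF _ open_ball]) auto
    have "((\<lambda>\<tau>. u \<tau> * exp (\<Phi> (u \<tau>))) has_field_derivative
        u' * exp (\<Phi> (u \<tau>)) + (exp (\<Phi> (u \<tau>)) * (deriv \<Phi> w * u')) * u \<tau>) (at \<tau>)"
      using DERIV_mult[OF du DERIV_fun_exp[OF DERIV_chain2[OF d\<Phi> du]]] by (simp add: add.commute mult_ac)
    then have "(nome N has_field_derivative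
        u' * exp (\<Phi> (u \<tau>)) + (exp (\<Phi> (u \<tau>)) * (deriv \<Phi> w * u')) * u \<tau>) (at \<tau>)"
      by (rule has_field_derivative_transform_within_open[OF _ open_halfspace_Im_gt[of Y]])
        (use \<tau>(1) u in auto)
    then have "u' * exp (\<Phi> (u \<tau>)) + (exp (\<Phi> (u \<tau>)) * (deriv \<Phi> w * u')) * u \<tau> =
        2 * of_real pi / of_nat N * \<i> * nome N \<tau>"
      using has_field_derivative_nome[OF N] by (rule DERIV_unique)
    then have "exp (\<Phi> w) * (u' * (1 + w * deriv \<Phi> w)) = exp (\<Phi> w) * (2 * of_real pi / of_nat N * \<i> * w)"
      by (simp add: uw \<tau>(2) algebra_simps)
    then have "u' * (1 + w * deriv \<Phi> w) = 2 * of_real pi / of_nat N * \<i> * w"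
      by (simp only: mult_left_cancel[OF exp_not_eq_zero])
    then have "norm (u' * (1 + w * deriv \<Phi> w)) = norm (2 * of_real pi / of_nat N * \<i> * w)"
      by simp
    then have u'_norm: "norm u' * norm (1 + w * deriv \<Phi> w) = 2 * pi / of_nat N * norm w"
      by (simp add: norm_mult norm_divide)
    have "exp (- (2 * pi / of_nat N * Im \<tau>)) = norm w * exp (Re (\<Phi> w))"
      using norm_nome[of N \<tau>] by (simp add: \<tau>(2) norm_mult)
    then have "- (2 * pi / of_nat N * Im \<tau>) = ln (norm w * exp (Re (\<Phi> w)))"
      by (metis ln_exp)
    also have "\<dots> = ln (norm w) + Re (\<Phi> w)"
      using elim(3) by (simp add: ln_mult)
    finally have "\<bar>ln (norm w) + Re (\<Phi> w)\<bar> = \<bar>- (2 * pi / of_nat N * Im \<tau>)\<bar>"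
      by simp
    also have "\<dots> = 2 * pi / of_nat N * Im \<tau>"
      using Im by (simp add: abs_mult)
    finally have ln_eq: "\<bar>ln (norm w) + Re (\<Phi> w)\<bar> = 2 * pi / of_nat N * Im \<tau>" .
    have dg: "norm (deriv ?g \<tau>) = norm A * norm u'"
      using A by (simp add: u'_def norm_divide)
    have u'0: "norm u' \<noteq> 0"
      using u'_norm elim(3) N by auto
    define r where "r = norm (1 + w * deriv \<Phi> w) / (norm (A * w) * \<bar>ln (norm w) + Re (\<Phi> w)\<bar>)"
    have r: "r * norm (deriv ?g \<tau>) = 1 / Im \<tau>"
    proof -
      have "r * norm (deriv ?g \<tau>) =
          (norm u' * norm (1 + w * deriv \<Phi> w)) / (norm w * (2 * pi / of_nat N * Im \<tau>))"
        using A by (simp add: r_def ln_eq dg norm_mult mult_ac)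
      also have "\<dots> = 1 / Im \<tau>"
        unfolding u'_norm using N elim(3) Im by simp
      finally show ?thesis .
    qed
    \<comment> \<open>Invariance along the fibre shows that \<open>r\<close> meets the requirement;
      it is the only such number because the derivative at \<open>\<tau>\<close> is nonzero.\<close>
    show ?case
      unfolding induced_density_def poincare_density_def r_def[symmetric]
    proof (rule the_equality)
      show "\<forall>\<tau>'\<in>upper_half_plane. f \<tau>' = Aff (A * w) \<longrightarrow> r * norm (deriv ?g \<tau>') = 1 / Im \<tau>'"
      proof (intro ballI impI)
        fix \<tau>' assume \<tau>': "\<tau>' \<in> upper_half_plane" "f \<tau>' = Aff (A * w)"
        have Im': "Im \<tau>' > 0"
          using \<tau>'(1) by (simp add: upper_half_plane_def)
        have "norm (deriv ?g \<tau>) * Im \<tau> = norm (deriv ?g \<tau>') * Im \<tau>'"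
          using norm_deriv_times_Im_eq[OF H \<tau>'(1)] \<tau>(3) \<tau>'(2) by simp
        then have "r * norm (deriv ?g \<tau>') * Im \<tau>' = r * norm (deriv ?g \<tau>) * Im \<tau>"
          by simp
        also have "\<dots> = 1"
          using r Im by simp
        finally show "r * norm (deriv ?g \<tau>') = 1 / Im \<tau>'"
          using Im' by (simp add: field_simps)
      qed
    next
      fix s assume "\<forall>\<tau>'\<in>upper_half_plane. f \<tau>' = Aff (A * w) \<longrightarrow> s * norm (deriv ?g \<tau>') = 1 / Im \<tau>'"
      then have "s * norm (deriv ?g \<tau>) = r * norm (deriv ?g \<tau>)"
        using H \<tau>(3) r by simp
      then show "s = r"
        using dg A u'0 by simp
    qed
  qed
qed

end

section \<open>Comparison of two coverings\<close>

lemma (in cusp_cover) ex_G_eq: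
  assumes "z \<notin> E"
  shows "\<exists>\<tau>. \<tau> \<in> upper_half_plane \<and> G \<tau> = z"
proof -
  have "z \<in> G ` upper_half_plane"
    using assms covering_space_imp_surjective[OF covering_G] by simp
  then show ?thesis
    by (elim imageE) (intro exI conjI, simp_all)
qed

lemma (in cusp_cover) G_notin_E:
  assumes "\<tau> \<in> upper_half_plane"
  shows "G \<tau> \<notin> E"
proof -
  have "G \<tau> \<in> G ` upper_half_plane"
    using assms by (rule imageI)
  then show ?thesis
    using covering_space_imp_surjective[OF covering_G] by simp
qed

text \<open>\<open>src\<close> serves as the reference covering, \<open>tgt\<close> is arbitrary.
  They share \<open>N\<close> and hence the deck group; no relation between their punctures is
  assumed.\<close>

locale cusp_cover_pair =
  src: cusp_cover N n0 a0 f0 A0 B0 + tgt: cusp_cover N n a f A B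
  for N n0 a0 f0 A0 B0 n a f A B +
  fixes \<Phi>0 \<Phi> :: "complex \<Rightarrow> complex"
  assumes log0: "cusp_log N f0 A0 \<Phi>0" and A0: "A0 \<noteq> 0"
    and log: "cusp_log N f A \<Phi>" and A: "A \<noteq> 0"
begin

text \<open>Both fibres are orbits of the same group.\<close>

lemma G_eq_iff:
  assumes "\<tau> \<in> upper_half_plane" "\<tau>' \<in> upper_half_plane"
  shows "src.G \<tau> = src.G \<tau>' \<longleftrightarrow> tgt.G \<tau> = tgt.G \<tau>'"
  using src.f_eq_iff[OF assms] tgt.f_eq_iff[OF assms]
    src.f_eq_iff_G_eq[OF assms] tgt.f_eq_iff_G_eq[OF assms] by simp

text \<open>Large values of \<open>tgt.G\<close> are attained high up in the upper half plane, where \<open>src.G\<close> is large,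
  and the fibres of the two functions agree.\<close>

lemma G_bounded:
  obtains K where "\<And>\<tau>. \<tau> \<in> upper_half_plane \<Longrightarrow> norm (src.G \<tau>) \<le> R \<Longrightarrow> norm (tgt.G \<tau>) \<le> K"
proof -
  define R' where "R' = max R 1"
  have R': "R' > 0"
    by (simp add: R'_def)
  then have "1 / (norm A0 * R') > 0"
    using A0 by simp
  then obtain Y where Y: "\<forall>\<tau>. Im \<tau> > Y \<longrightarrow> (\<exists>w. w \<noteq> 0 \<and> norm w < 1 / (norm A0 * R') \<and>
      nome N \<tau> = w * exp (\<Phi>0 w) \<and> f0 \<tau> = Aff (A0 * w))"
    using log0 unfolding cusp_log_def by blast
  have "\<forall>\<^sub>F w in at 0. \<exists>\<tau>. Im \<tau> > max 0 Y \<and> nome N \<tau> = w * exp (\<Phi> w) \<and> f \<tau> = Aff (A * w)"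
    using log unfolding cusp_log_def by blast
  then obtain d where d: "d > 0" "\<And>w. w \<noteq> 0 \<Longrightarrow> norm w < d \<Longrightarrow>
      \<exists>\<tau>. Im \<tau> > max 0 Y \<and> nome N \<tau> = w * exp (\<Phi> w) \<and> f \<tau> = Aff (A * w)"
    unfolding eventually_at by (auto simp: dist_norm)
  have "norm (tgt.G \<tau>) \<le> 1 / (norm A * d)" if \<tau>: "\<tau> \<in> upper_half_plane" "norm (src.G \<tau>) \<le> R" for \<tau>
  proof (rule ccontr)
    assume "\<not> ?thesis"
    then have big: "1 / (norm A * d) < norm (tgt.G \<tau>)"
      by simp
    then have "0 < norm (tgt.G \<tau>)"
      using d(1) by (intro le_less_trans[OF _ big]) auto
    define w where "w = 1 / (A * tgt.G \<tau>)"
    have "w \<noteq> 0"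
      using A \<open>0 < norm (tgt.G \<tau>)\<close> by (auto simp: w_def)
    moreover have "norm w < d"
      using big A d(1) \<open>0 < norm (tgt.G \<tau>)\<close> by (simp add: w_def norm_divide norm_mult field_simps)
    ultimately obtain \<tau>' where \<tau>': "Im \<tau>' > max 0 Y" "f \<tau>' = Aff (A * w)"
      using d(2) by blast
    have H: "\<tau>' \<in> upper_half_plane"
      using \<tau>'(1) by (simp add: upper_half_plane_def)
    have "tgt.G \<tau>' = tgt.G \<tau>"
      using \<tau>'(2) A by (simp add: tgt.G_def w_def)
    then have eq: "src.G \<tau>' = src.G \<tau>"
      using G_eq_iff[OF H \<tau>(1)] by simp
    obtain w0 where w0: "w0 \<noteq> 0" "norm w0 < 1 / (norm A0 * R')" "f0 \<tau>' = Aff (A0 * w0)"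
      using Y \<tau>'(1) by auto
    have "R' < norm (src.G \<tau>')"
      using w0 A0 R' by (simp add: src.G_def norm_divide norm_mult field_simps)
    then show False
      using \<tau>(2) by (simp add: eq R'_def)
  qed
  then show ?thesis
    using that by blast
qed

text \<open>\<open>T\<close> is well defined because the fibres agree, and locally it is
  \<open>tgt.G\<close> composed with a holomorphic inverse of \<open>src.G\<close> on a
  sheet.\<close>

lemma ex_transition:
  "\<exists>T. T holomorphic_on - src.E \<and> (\<forall>\<tau>\<in>upper_half_plane. T (src.G \<tau>) = tgt.G \<tau>)"
proof -
  define T where "T z = tgt.G (SOME \<tau>. \<tau> \<in> upper_half_plane \<and> src.G \<tau> = z)" for z
  have T: "T (src.G \<tau>) = tgt.G \<tau>" if "\<tau> \<in> upper_half_plane" for \<tau>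
  proof -
    have "\<exists>\<tau>'. \<tau>' \<in> upper_half_plane \<and> src.G \<tau>' = src.G \<tau>"
      using that by blast
    from someI_ex[OF this] show ?thesis
      using G_eq_iff[of "SOME \<tau>'. \<tau>' \<in> upper_half_plane \<and> src.G \<tau>' = src.G \<tau>" \<tau>] that
      unfolding T_def by simp
  qed
  have "T holomorphic_on - src.E"
  proof (rule holomorphic_onI)
    fix z assume "z \<in> - src.E"
    then obtain \<tau> where \<tau>: "\<tau> \<in> upper_half_plane" "src.G \<tau> = z"
      using src.ex_G_eq[of z] by auto
    obtain t U q where t: "\<tau> \<in> t" "openin (top_of_set upper_half_plane) t" "src.G \<tau> \<in> U"
        "openin (top_of_set (- src.E)) U" "homeomorphism t U src.G q"
      by (rule covering_space_local_homeomorphism[OF src.covering_G \<tau>(1)]) (rule that)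
    have t_sub: "t \<subseteq> upper_half_plane"
      using t(2) by (rule openin_imp_subset)
    have "open t"
      using t(2) by (simp add: openin_open_eq upper_half_plane_properties(1))
    have inj: "inj_on src.G t"
      using homeomorphism_apply1[OF t(5)] by (rule inj_on_inverseI)
    have hol: "src.G holomorphic_on t"
      using src.holomorphic_G t_sub by (rule holomorphic_on_subset)
    obtain g where g: "g holomorphic_on (src.G ` t)"
        "\<And>z. z \<in> t \<Longrightarrow> deriv src.G z * deriv g (src.G z) = 1" "\<And>z. z \<in> t \<Longrightarrow> g (src.G z) = z"
      by (rule holomorphic_has_inverse[OF hol \<open>open t\<close> inj]) blast
    have open_im: "open (src.G ` t)"
      by (rule open_mapping_thm3[OF hol \<open>open t\<close> inj])
    have "(tgt.G \<circ> g) holomorphic_on (src.G ` t)"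
      using g t_sub by (intro holomorphic_on_compose_gen[OF g(1) tgt.holomorphic_G]) auto
    then have "T holomorphic_on (src.G ` t)"
      by (rule holomorphic_transform) (use g(3) T t_sub in auto)
    then have "T field_differentiable at z"
      using open_im t(1) \<tau>(2) by (intro holomorphic_on_imp_differentiable_at) auto
    then show "T field_differentiable at z within - src.E"
      by (rule field_differentiable_at_within)
  qed
  then show ?thesis
    using T by (intro exI[of _ T]) simp
qed

text \<open>The transition map from \<open>src.G\<close> to \<open>tgt.G\<close> is bounded near the finite punctures, hence entire,
  and it grows at most linearly.\<close>

lemma G_affine:
  obtains \<alpha> \<beta> where "\<alpha> \<noteq> 0" "\<And>\<tau>. \<tau> \<in> upper_half_plane \<Longrightarrow> tgt.G \<tau> = \<alpha> * src.G \<tau> + \<beta>"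
proof -
  obtain T where T_hol: "T holomorphic_on - src.E" and T_ball: "\<forall>\<tau>\<in>upper_half_plane. T (src.G \<tau>) = tgt.G \<tau>"
    using ex_transition by blast
  have T: "T (src.G \<tau>) = tgt.G \<tau>" if "\<tau> \<in> upper_half_plane" for \<tau>
    using T_ball that by simp
  \<comment> \<open>A punctured neighbourhood of \<open>z\<close> consists of values of
    \<open>src.G\<close> of norm at most \<open>norm z + 1\<close>, so \<open>G_bounded\<close>
    applies and the singularity is removable.\<close>
  have bigo: "T \<in> O[at z](\<lambda>_. 1)" if z: "z \<in> src.E" for z
  proof -
    obtain K where K: "\<And>\<tau>. \<tau> \<in> upper_half_plane \<Longrightarrow> norm (src.G \<tau>) \<le> norm z + 1 \<Longrightarrow> norm (tgt.G \<tau>) \<le> K"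
      by (rule G_bounded) blast
    have "open (ball z 1 - (src.E - {z}))"
      using src.finite_E by (intro open_Diff open_ball finite_imp_closed) auto
    then have "\<forall>\<^sub>F y in at z. y \<in> ball z 1 - (src.E - {z})"
      by (rule eventually_at_in_open') auto
    then have "\<forall>\<^sub>F y in at z. norm (T y) \<le> K * norm (1 :: complex)"
      using eventually_neq_at_within[of z]
    proof eventually_elim
      case (elim y)
      then obtain \<tau> where \<tau>: "\<tau> \<in> upper_half_plane" "src.G \<tau> = y"
        using src.ex_G_eq[of y] by auto
      have "norm y \<le> norm z + 1"
        using elim(1) norm_triangle_sub[of y z] by (auto simp: dist_norm norm_minus_commute)
      then show ?case
        using K[OF \<tau>(1)] T[OF \<tau>(1)] \<tau>(2) by simp
    qed
    then show ?thesis
      by (rule bigoI)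
  qed
  obtain T' where T': "T' holomorphic_on UNIV" "\<forall>z\<in>UNIV - src.E. T' z = T z"
    using removable_singularities[of src.E UNIV T] src.finite_E T_hol bigo by (auto simp: Compl_eq_Diff_UNIV)
  have T'G: "T' (src.G \<tau>) = tgt.G \<tau>" if "\<tau> \<in> upper_half_plane" for \<tau>
    using T'(2) T[OF that] src.G_notin_E[OF that] by simp
  have cont: "((\<lambda>w. norm (exp (\<Psi> w))) \<longlongrightarrow> 1) (at 0)" if "\<Psi> analytic_on {0}" "\<Psi> 0 = 0" for \<Psi> :: "complex \<Rightarrow> complex"
  proof -
    have "isCont \<Psi> 0"
      using that(1) by (simp add: analytic_at_imp_isCont)
    then have "(\<Psi> \<longlongrightarrow> 0) (at 0)"
      using that(2) by (simp add: isCont_def)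
    then have "((\<lambda>w. norm (exp (\<Psi> w))) \<longlongrightarrow> norm (exp (0 :: complex))) (at 0)"
      by (intro tendsto_intros)
    then show ?thesis
      by simp
  qed
  have "\<forall>\<^sub>F w in at 0. norm (exp (\<Phi> w)) < 2"
    using log order_tendstoD(2)[OF cont[of \<Phi>], of 2] by (simp add: cusp_log_def)
  then obtain d where d: "0 < d" "\<And>w. w \<noteq> 0 \<Longrightarrow> norm w < d \<Longrightarrow> norm (exp (\<Phi> w)) < 2"
    unfolding eventually_at by (auto simp: dist_norm)
  obtain Y where Y: "\<forall>\<tau>. Im \<tau> > Y \<longrightarrow> (\<exists>w. w \<noteq> 0 \<and> norm w < d \<and>
      nome N \<tau> = w * exp (\<Phi> w) \<and> f \<tau> = Aff (A * w))"
    using log d(1) unfolding cusp_log_def by blast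
  have "\<forall>\<^sub>F w in at 0. 1 / 2 < norm (exp (\<Phi>0 w))"
    using log0 order_tendstoD(1)[OF cont[of \<Phi>0], of "1 / 2"] by (simp add: cusp_log_def)
  moreover have "\<forall>\<^sub>F w in at 0. \<exists>\<tau>. Im \<tau> > max 0 Y \<and> nome N \<tau> = w * exp (\<Phi>0 w) \<and> f0 \<tau> = Aff (A0 * w)"
    using log0 unfolding cusp_log_def by blast
  ultimately have "\<forall>\<^sub>F w in at 0. 1 / 2 < norm (exp (\<Phi>0 w)) \<and>
      (\<exists>\<tau>. Im \<tau> > max 0 Y \<and> nome N \<tau> = w * exp (\<Phi>0 w) \<and> f0 \<tau> = Aff (A0 * w))"
    by (rule eventually_conj)
  then obtain e where e: "0 < e" "\<And>w. w \<noteq> 0 \<Longrightarrow> norm w < e \<Longrightarrow> 1 / 2 < norm (exp (\<Phi>0 w)) \<and>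
      (\<exists>\<tau>. Im \<tau> > max 0 Y \<and> nome N \<tau> = w * exp (\<Phi>0 w) \<and> f0 \<tau> = Aff (A0 * w))"
    unfolding eventually_at by (auto simp: dist_norm)
  \<comment> \<open>The estimates \<open>norm w0 / 2 \<le> norm q \<le> 2 * norm w\<close> bound
    \<open>norm w0 / norm w\<close> by 4. The summand 1 makes \<open>norm w0 < e\<close>
    strict.\<close>
  have growth: "norm (T' z) \<le> (4 * norm A0 / norm A) * norm z ^ 1" if z: "1 / (norm A0 * e) + 1 \<le> norm z" for z :: complex
  proof -
    have "0 < 1 / (norm A0 * e)"
      using A0 e(1) by simp
    then have zpos: "0 < norm z" and big: "1 / (norm A0 * e) < norm z"
      using z by linarith+
    define w0 where "w0 = 1 / (A0 * z)"
    have w0: "w0 \<noteq> 0"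
      using A0 zpos by (simp add: w0_def)
    have "norm w0 < e"
      using big zpos A0 e(1) by (simp add: w0_def norm_divide norm_mult field_simps)
    from e(2)[OF w0 this] obtain \<tau> where \<tau>: "Im \<tau> > max 0 Y" "nome N \<tau> = w0 * exp (\<Phi>0 w0)"
        "f0 \<tau> = Aff (A0 * w0)" and half: "1 / 2 < norm (exp (\<Phi>0 w0))"
      by blast
    have H: "\<tau> \<in> upper_half_plane"
      using \<tau>(1) by (simp add: upper_half_plane_def)
    have G0: "src.G \<tau> = z"
      using \<tau>(3) A0 by (simp add: src.G_def w0_def)
    obtain w where w: "w \<noteq> 0" "norm w < d" "nome N \<tau> = w * exp (\<Phi> w)" "f \<tau> = Aff (A * w)"
      using Y \<tau>(1) by auto
    have "norm w0 * (1 / 2) \<le> norm (w0 * exp (\<Phi>0 w0))"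
      unfolding norm_mult using half by (intro mult_left_mono) auto
    also have "\<dots> = norm w * norm (exp (\<Phi> w))"
      by (simp only: \<tau>(2)[symmetric] w(3)[symmetric] norm_mult[symmetric])
    also have "\<dots> \<le> norm w * 2"
      using d(2)[OF w(1,2)] by (intro mult_left_mono) auto
    finally have w_ge: "norm w0 \<le> 4 * norm w"
      by simp
    have "norm (T' z) = 1 / (norm A * norm w)"
      using T'G[OF H] G0 w(4) by (simp add: tgt.G_def norm_divide norm_mult)
    also have "\<dots> \<le> 4 / (norm A * norm w0)"
      using w_ge A w0 w(1) by (simp add: field_simps)
    also have "\<dots> = 4 * norm A0 / norm A * norm z ^ 1"
      using A A0 zpos by (simp add: w0_def norm_divide norm_mult)
    finally show ?thesis .
  qed
  \<comment> \<open>By Liouville, an entire function of at most linear growth is a polynomial of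
    degree at most 1.\<close>
  have "T' z = deriv T' 0 * z + T' 0" for z
    using Liouville_polynomial[OF T'(1) growth, where \<xi> = z] by simp
  then have aff: "tgt.G \<tau> = deriv T' 0 * src.G \<tau> + T' 0" if "\<tau> \<in> upper_half_plane" for \<tau>
    using T'G[OF that] by metis
  \<comment> \<open>Otherwise \<open>tgt.G\<close> would be constant, while it takes every value off
    a finite set.\<close>
  have "deriv T' 0 \<noteq> 0"
  proof
    assume "deriv T' 0 = 0"
    then have "z \<in> insert (T' 0) tgt.E" for z
      using tgt.ex_G_eq[of z] aff by auto
    then have "UNIV \<subseteq> insert (T' 0) tgt.E"
      by blast
    then have "finite (UNIV :: complex set)"
      using tgt.finite_E by (simp add: finite_subset)
    then show False
      using infinite_UNIV_char_0 by blast
  qed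
  then show ?thesis
    using that aff by blast
qed

end

context cusp_cover_pair
begin

text \<open>The affine relation between \<open>1/f\<^sub>0\<close> and \<open>1/f\<close> reads \<open>f\<^sub>0 / A\<^sub>0 = \<kappa> w / (1 - c w)\<close> with \<open>w = f / A\<close>;
  comparing the values of \<open>q / w\<close> as \<open>w\<close> tends to \<open>0\<close> shows \<open>\<kappa> = 1\<close>.\<close>

lemma ex_cusp_log_eq:
  "\<exists>c. \<forall>\<^sub>F w in nhds 0. \<Phi>0 (w / (1 - c * w)) - Ln (1 - c * w) = \<Phi> w"
proof -
  obtain \<alpha> \<beta> where \<alpha>: "\<alpha> \<noteq> 0"
    and affine: "\<And>\<tau>. \<tau> \<in> upper_half_plane \<Longrightarrow> tgt.G \<tau> = \<alpha> * src.G \<tau> + \<beta>"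
    by (rule G_affine) blast
  \<comment> \<open>Solving \<open>1 / (A * w) = \<alpha> / f0 + \<beta>\<close> for
    \<open>f0 / A0\<close> gives these constants and \<open>u w\<close>.\<close>
  define c where "c = \<beta> * A"
  define \<kappa> where "\<kappa> = \<alpha> * A / A0"
  have \<kappa>: "\<kappa> \<noteq> 0"
    using \<alpha> A A0 by (simp add: \<kappa>_def)
  define u where "u w = \<kappa> * w / (1 - c * w)" for w
  have lim_c: "((\<lambda>w. 1 - c * w) \<longlongrightarrow> 1) (at 0)"
    by (auto intro!: tendsto_eq_intros)
  have ev_c: "\<forall>\<^sub>F w in at 0. 1 - c * w \<noteq> 0"
    by (rule tendsto_imp_eventually_ne[OF lim_c]) simp
  have lim_u: "(u \<longlongrightarrow> 0) (at 0)"
    unfolding u_def by (auto intro!: tendsto_eq_intros)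
  have ev_u: "\<forall>\<^sub>F w in at 0. u w \<noteq> 0"
    using ev_c eventually_neq_at_within[of 0] by eventually_elim (simp add: u_def \<kappa>)
  have filter_u: "filterlim u (at 0) (at 0)"
    using lim_u ev_u by (simp add: filterlim_at)
  have zero: "\<Phi> 0 = 0" "\<Phi>0 0 = 0" and ana: "\<Phi> analytic_on {0}" "\<Phi>0 analytic_on {0}"
    using log log0 by (auto simp: cusp_log_def)
  have lim_\<Phi>: "(\<Phi> \<longlongrightarrow> 0) (at 0)" and lim_\<Phi>0: "(\<Phi>0 \<longlongrightarrow> 0) (at 0)"
    using analytic_at_imp_isCont[OF ana(1)] analytic_at_imp_isCont[OF ana(2)] zero
    by (simp_all add: isCont_def)
  have lim_\<Phi>0u: "((\<lambda>w. \<Phi>0 (u w)) \<longlongrightarrow> 0) (at 0)"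
    by (rule filterlim_compose[OF lim_\<Phi>0 filter_u])
  have "\<forall>\<^sub>F w in at 0. \<exists>\<tau>. Im \<tau> > 1 \<and> nome N \<tau> = w * exp (\<Phi> w) \<and> f \<tau> = Aff (A * w)"
    using log unfolding cusp_log_def by blast
  moreover have "\<forall>\<^sub>F w in at 0. \<exists>\<tau>. Im \<tau> > 1 \<and> nome N \<tau> = w * exp (\<Phi>0 w) \<and> f0 \<tau> = Aff (A0 * w)"
    using log0 unfolding cusp_log_def by blast
  then have "\<forall>\<^sub>F w in at 0. \<exists>\<tau>. Im \<tau> > 1 \<and> nome N \<tau> = u w * exp (\<Phi>0 (u w)) \<and> f0 \<tau> = Aff (A0 * u w)"
    by (rule eventually_compose_filterlim[OF _ filter_u])
  ultimately have exp_eq: "\<forall>\<^sub>F w in at 0. exp (\<Phi> w) = \<kappa> / (1 - c * w) * exp (\<Phi>0 (u w))"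
    using ev_c ev_u eventually_neq_at_within[of 0]
  proof eventually_elim
    case (elim w)
    obtain \<tau> where \<tau>: "Im \<tau> > 1" "nome N \<tau> = w * exp (\<Phi> w)" "f \<tau> = Aff (A * w)"
      using elim(1) by blast
    obtain \<tau>' where \<tau>': "Im \<tau>' > 1" "nome N \<tau>' = u w * exp (\<Phi>0 (u w))" "f0 \<tau>' = Aff (A0 * u w)"
      using elim(2) by blast
    have H: "\<tau> \<in> upper_half_plane" "\<tau>' \<in> upper_half_plane"
      using \<tau>(1) \<tau>'(1) by (auto simp: upper_half_plane_def)
    \<comment> \<open>\<open>u w\<close> is the source coordinate with the same affine image, so
      \<open>\<tau>\<close> and \<open>\<tau>'\<close> lie in one fibre. Both are above height 1,
      hence have equal nomes.\<close>
    have "\<alpha> * src.G \<tau> + \<beta> = 1 / (A * w)"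
      using affine[OF H(1)] \<tau>(3) by (simp add: tgt.G_def)
    moreover have "\<alpha> * src.G \<tau>' + \<beta> = 1 / (A * w)"
      using \<tau>'(3) elim(3,5) \<alpha> A A0 by (simp add: src.G_def u_def \<kappa>_def c_def field_simps)
    ultimately have "src.G \<tau> = src.G \<tau>'"
      using \<alpha> by (metis add_right_cancel mult_left_cancel)
    then have "f0 \<tau> = f0 \<tau>'"
      using src.f_eq_iff_G_eq[OF H] by simp
    then have "nome N \<tau> = nome N \<tau>'"
      using \<tau>(1) \<tau>'(1) by (rule src.nome_eq_of_f_eq)
    then have "w * exp (\<Phi> w) = w * (\<kappa> / (1 - c * w) * exp (\<Phi>0 (u w)))"
      using \<tau>(2) \<tau>'(2) by (simp add: u_def)
    then show ?case
      using elim(5) by (simp only: mult_left_cancel[OF elim(5)])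
  qed
  have "\<kappa> = 1"
  proof (rule tendsto_unique)
    have "((\<lambda>w. \<kappa> / (1 - c * w) * exp (\<Phi>0 (u w))) \<longlongrightarrow> \<kappa> / 1 * exp 0) (at 0)"
      by (intro tendsto_intros lim_c lim_\<Phi>0u) auto
    then show "((\<lambda>w. exp (\<Phi> w)) \<longlongrightarrow> \<kappa>) (at 0)"
      using tendsto_cong[OF exp_eq] by simp
    have "((\<lambda>w. exp (\<Phi> w)) \<longlongrightarrow> exp 0) (at 0)"
      by (intro tendsto_intros lim_\<Phi>)
    then show "((\<lambda>w. exp (\<Phi> w)) \<longlongrightarrow> 1) (at 0)"
      by simp
  qed simp
  then have u: "u w = w / (1 - c * w)" for w
    by (simp add: u_def)
  let ?\<Psi> = "\<lambda>w. \<Phi>0 (u w) - Ln (1 - c * w)"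
  \<comment> \<open>Two logarithms of one number differ by a multiple of \<open>2 pi i\<close>; as
    the difference tends to 0, it vanishes near 0.\<close>
  have "((\<lambda>w. ?\<Psi> w - \<Phi> w) \<longlongrightarrow> 0 - Ln 1 - 0) (at 0)"
    by (intro tendsto_diff tendsto_Ln lim_\<Phi>0u lim_c lim_\<Phi>) auto
  then have "((\<lambda>w. norm (?\<Psi> w - \<Phi> w)) \<longlongrightarrow> 0) (at 0)"
    by (simp add: tendsto_norm_zero_iff)
  then have "\<forall>\<^sub>F w in at 0. norm (?\<Psi> w - \<Phi> w) < 2 * pi"
    by (rule order_tendstoD) simp
  then have "\<forall>\<^sub>F w in at 0. ?\<Psi> w = \<Phi> w"
    using exp_eq ev_c
  proof eventually_elim
    case (elim w)
    show ?case
    proof (rule exp_complex_eqI)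
      have "\<bar>Im (?\<Psi> w) - Im (\<Phi> w)\<bar> \<le> norm (?\<Psi> w - \<Phi> w)"
        using abs_Im_le_cmod[of "?\<Psi> w - \<Phi> w"] by simp
      then show "\<bar>Im (?\<Psi> w) - Im (\<Phi> w)\<bar> < 2 * pi"
        using elim(1) by linarith
      show "exp (?\<Psi> w) = exp (\<Phi> w)"
        using elim(2,3) \<open>\<kappa> = 1\<close> by (simp add: exp_diff)
    qed
  qed
  moreover have "?\<Psi> 0 = \<Phi> 0"
    by (simp add: u zero)
  ultimately have "\<forall>\<^sub>F w in nhds 0. ?\<Psi> w = \<Phi> w"
    by (simp add: eventually_nhds_conv_at)
  then show ?thesis
    unfolding u by (rule exI)
qed

text \<open>Comparing first coefficients forces \<open>c = B0 / A0 - B / A\<close>. Once the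
  reference is fixed, the expansion of \<open>\<Phi>\<close> therefore depends on the covering only
  through \<open>B / A\<close>.\<close>

lemma cusp_log_has_fps_expansion:
  assumes d0: "(\<Phi>0 has_field_derivative - (B0 / A0)) (at 0)"
    and d: "(\<Phi> has_field_derivative - (B / A)) (at 0)"
    and P: "\<Phi>0 has_fps_expansion P"
  shows "\<Phi> has_fps_expansion change_coord P (B0 / A0 - B / A)"
proof -
  obtain c where c: "\<forall>\<^sub>F w in nhds 0. \<Phi>0 (w / (1 - c * w)) - Ln (1 - c * w) = \<Phi> w"
    using ex_cusp_log_eq by blast
  have exp: "\<Phi> has_fps_expansion change_coord P c"
    using has_fps_expansion_change_coord[OF P, of c] has_fps_expansion_cong[OF c refl] by blast
  have "fps_nth P 1 = - (B0 / A0)"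
    using fps_nth_fps_expansion[OF P, of 1] DERIV_imp_deriv[OF d0] by simp
  moreover have "fps_nth (change_coord P c) 1 = - (B / A)"
    using fps_nth_fps_expansion[OF exp, of 1] DERIV_imp_deriv[OF d] by simp
  ultimately have "c = B0 / A0 - B / A"
    unfolding fps_nth_change_coord_1 by (simp add: algebra_simps)
  then show ?thesis
    using exp by simp
qed

end

section \<open>The expansion\<close>

lemma eventually_cusp_bounds:
  fixes K :: real
  assumes "0 < K"
  shows "\<forall>\<^sub>F w :: complex in at 0. 3 * K * norm w < 1 / 2 \<and> 1 \<le> \<bar>ln (norm w)\<bar>"
proof -
  have "0 < 1 / (6 * K)"
    using assms by simp
  then have "\<forall>\<^sub>F w :: complex in at 0. norm w < 1 / (6 * K)"
    by (rule eventually_at_norm_less)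
  moreover have "\<forall>\<^sub>F w :: complex in at 0. norm w < exp (- 1)"
    by (rule eventually_at_norm_less) simp
  ultimately show ?thesis
    using eventually_neq_at_within[of 0]
  proof eventually_elim
    case (elim w)
    have "ln (norm w) < ln (exp (- 1))"
      using elim by (subst ln_less_cancel_iff) auto
    then show ?case
      using elim(1) assms by (auto simp: field_simps)
  qed
qed

lemma filterlim_divide_at_0:
  fixes A :: complex
  assumes "A \<noteq> 0"
  shows "filterlim (\<lambda>z. z / A) (at 0) (at 0)"
  unfolding filterlim_at
  using assms eventually_neq_at_within[of 0] by (auto intro!: tendsto_eq_intros elim: eventually_mono)

context cusp_cover
begin

context
  fixes \<Phi> :: "complex \<Rightarrow> complex" and F :: "complex fps" and K :: real
  assumes log: "cusp_log N f A \<Phi>" and A: "A \<noteq> 0"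
    and d\<Phi>: "(\<Phi> has_field_derivative - (B / A)) (at 0)"
    and F: "\<Phi> has_fps_expansion F"
    and K: "0 < K" "\<And>k. 0 < k \<Longrightarrow> norm (of_nat k * fps_nth F k) \<le> K ^ k"
begin

abbreviation "V w \<equiv> cusp_coeff (fps_nth F) w (ln (norm w))"

text \<open>Factoring \<open>ln (norm w)\<close> out of \<open>ln (norm w) + Re (\<Phi> w)\<close>
  turns the density into the quotient that \<open>cusp_coeff\<close> expands. Its coefficients of
  index 0 and 1 are the explicit terms.\<close>

lemma eventually_density_expansion:
  "\<forall>\<^sub>F w in at 0. summable (\<lambda>k. V w (k + 2)) \<and>
     induced_density f (A * w) = 1 / (norm (A * w) * \<bar>ln (norm w)\<bar>) *
       norm (1 - (B / A * w - of_real (Re (B / A * w) / ln (norm w))) + suminf (\<lambda>k. V w (k + 2)))"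
proof -
  have F0: "fps_nth F 0 = 0"
    using fps_nth_fps_expansion[OF F, of 0] log by (simp add: cusp_log_def)
  have F1: "fps_nth F 1 = - (B / A)"
    using fps_nth_fps_expansion[OF F, of 1] DERIV_imp_deriv[OF d\<Phi>] by simp
  have expansion_sums: "\<forall>\<^sub>F w in at 0. (\<lambda>k. fps_nth H k * w ^ k) sums h w"
    if H: "h has_fps_expansion H" for h H
  proof -
    obtain r where r: "0 < r" "ereal r < fps_conv_radius H"
      using H ereal_dense2[of 0 "fps_conv_radius H"] by (auto simp: has_fps_expansion_def)
    have "\<forall>\<^sub>F w in at 0. eval_fps H w = h w"
      using H by (simp add: has_fps_expansion_def eventually_nhds_conv_at)
    then show ?thesis
      using eventually_at_norm_less[OF r(1)]
    proof eventually_elim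
      case (elim w)
      have "ereal (norm w) < fps_conv_radius H"
        using less_trans[OF _ r(2), of "ereal (norm w)"] elim(2) by simp
      then show ?case
        using sums_eval_fps[of w H] elim(1) by simp
    qed
  qed
  have XF: "(\<lambda>w. w * deriv \<Phi> w) has_fps_expansion (fps_X * fps_deriv F)"
    by (intro has_fps_expansion_mult has_fps_expansion_fps_X has_fps_expansion_deriv F)
  have XF_nth: "fps_nth (fps_X * fps_deriv F) k = of_nat k * fps_nth F k" for k
    by (cases k) auto
  have "isCont \<Phi> 0"
    using d\<Phi> by (rule DERIV_isCont)
  then have "(\<Phi> \<longlongrightarrow> 0) (at 0)"
    using log by (simp add: isCont_def cusp_log_def)
  then have "\<forall>\<^sub>F w in at 0. norm (\<Phi> w) < 1"
    by (intro order_tendstoD(2)[of _ 0]) (simp_all add: tendsto_norm_zero_iff)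
  then show ?thesis
    using expansion_sums[OF F] expansion_sums[OF XF] eventually_cusp_bounds[OF K(1)]
      eventually_induced_density[OF log A] eventually_neq_at_within[of 0]
  proof eventually_elim
    case (elim w)
    let ?l = "ln (norm w)"
    have l: "1 \<le> \<bar>?l\<bar>" and small: "3 * K * norm w < 1" and K0: "0 \<le> K"
      using elim(4) K(1) by auto
    have "summable (\<lambda>m. norm (V w m))"
      by (rule summable_norm_cusp_coeff[OF K(2) l K0 small])
    then have summable: "summable (V w)"
      by (rule summable_norm_cancel)
    have "suminf (V w) * of_real (1 + Re (\<Phi> w) / ?l) = 1 + w * deriv \<Phi> w"
      using elim(2,3) unfolding XF_nth
      by (intro suminf_cusp_coeff[OF K(2) l K0 small F0])
    then have prod: "norm (suminf (V w)) * \<bar>1 + Re (\<Phi> w) / ?l\<bar> = norm (1 + w * deriv \<Phi> w)"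
      by (metis norm_mult norm_of_real)
    \<comment> \<open>This keeps the denominator \<open>1 + Re (\<Phi> w) / ?l\<close> away from 0,
      so that it can be cancelled.\<close>
    have "\<bar>Re (\<Phi> w) / ?l\<bar> < 1"
    proof -
      have "\<bar>Re (\<Phi> w)\<bar> < 1"
        using abs_Re_le_cmod[of "\<Phi> w"] elim(1) by linarith
      then have "\<bar>Re (\<Phi> w)\<bar> < \<bar>?l\<bar>"
        using l by linarith
      then show ?thesis
        using l by (simp add: abs_divide divide_less_eq)
    qed
    then have pos: "0 < \<bar>1 + Re (\<Phi> w) / ?l\<bar>"
      by linarith
    have "?l + Re (\<Phi> w) = ?l * (1 + Re (\<Phi> w) / ?l)"
      using l by (simp add: ring_distribs)
    then have abs_l: "\<bar>?l + Re (\<Phi> w)\<bar> = \<bar>?l\<bar> * \<bar>1 + Re (\<Phi> w) / ?l\<bar>"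
      by (simp only: abs_mult)
    have "induced_density f (A * w) = 1 / (norm (A * w) * \<bar>?l\<bar>) * norm (suminf (V w))"
      unfolding elim(5) abs_l prod[symmetric] using pos by simp
    moreover have "suminf (V w) = suminf (\<lambda>k. V w (k + 2)) + (\<Sum>k<2. V w k)"
      by (rule suminf_split_initial_segment[OF summable])
    moreover have "(\<Sum>k<2. V w k) = V w 0 + V w (Suc 0)"
      by (simp add: numeral_2_eq_2)
    moreover have "V w 0 = 1"
      by (subst cusp_coeff.simps) simp
    moreover have "V w (Suc 0) = - (B / A * w - of_real (Re (B / A * w) / ?l))"
      unfolding cusp_coeff_Suc_0 F1 by (simp del: times_complex.sel)
    moreover have "summable (\<lambda>k. V w (k + 2))"
      using summable by (rule summable_ignore_initial_segment)
    ultimately show ?case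
      by (simp add: algebra_simps)
  qed
qed

lemma suminf_tail_bigo:
  "(\<lambda>z. suminf (\<lambda>k. V (z / A) (k + M))) \<in> O[at 0](\<lambda>z. z ^ M)"
proof (rule bigoI)
  have "\<forall>\<^sub>F z in at 0. 3 * K * norm (z / A) < 1 / 2 \<and> 1 \<le> \<bar>ln (norm (z / A))\<bar>"
    by (rule eventually_compose_filterlim[OF eventually_cusp_bounds[OF K(1)] filterlim_divide_at_0[OF A]])
  then show "\<forall>\<^sub>F z in at 0. norm (suminf (\<lambda>k. V (z / A) (k + M))) \<le> 2 * (3 * K / norm A) ^ M * norm (z ^ M)"
  proof eventually_elim
    case (elim z)
    have "norm (suminf (\<lambda>k. V (z / A) (k + M))) \<le> 2 * (3 * K * norm (z / A)) ^ M"
      using elim K(1) by (intro suminf_cusp_coeff_tail_le[OF K(2)]) auto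
    also have "\<dots> = 2 * (3 * K / norm A) ^ M * norm (z ^ M)"
      by (simp add: norm_divide norm_power power_mult_distrib power_divide)
    finally show ?case .
  qed
qed

end

end

theorem corollary3:
  fixes N :: nat
  assumes "N \<in> {2, 3, 4, 5}"
  shows "\<exists>R :: nat \<Rightarrow> cusp_var mpoly.
    (\<forall>m\<ge>2. mpoly_vars (R m) \<subseteq> cusp_vars m) \<and>
    (\<forall>(a :: nat \<Rightarrow> cp1) (f :: complex \<Rightarrow> cp1) (A :: complex) (B :: complex).
       inj_on a {1..num_punctures N} \<longrightarrow>
       a 1 = Aff 0 \<longrightarrow>
       covering_space upper_half_plane f (UNIV - a ` {1..num_punctures N}) \<longrightarrow>
       cp1_holomorphic_on f upper_half_plane \<longrightarrow>
       deck_group f = principal_congruence_group N \<longrightarrow>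
       vanishes_at_infinity f \<longrightarrow>
       has_q_expansion N f A B \<longrightarrow>
       (\<forall>\<^sub>F z in at 0.
          summable (\<lambda>k. cusp_term R A B (k + 2) z) \<and>
          induced_density f z =
            1 / (norm z * \<bar>ln (norm (z / A))\<bar>) *
            norm (1 - (B / A * (z / A)
                       - of_real (Re (B / A * (z / A)) / ln (norm (z / A))))
                    + suminf (\<lambda>k. cusp_term R A B (k + 2) z))) \<and>
       (\<forall>M\<ge>1. (\<lambda>z. suminf (\<lambda>k. cusp_term R A B (k + (M + 1)) z)) \<in> O[at 0](\<lambda>z. z ^ (M + 1))))"
proof -
  let ?n = "num_punctures N"
  have N: "0 < N" and n: "1 \<le> ?n"
    using assms by (auto simp: num_punctures_def)
  \<comment> \<open>If there is no such covering, the claim about coverings is vacuous and zero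
    polynomials do. Otherwise one covering is fixed as the reference.\<close>
  show ?thesis
  proof (cases "\<exists>a f A B. cusp_cover N ?n a f A B")
    case False
    show ?thesis
    proof (intro exI[of _ "\<lambda>_. 0"] conjI allI impI)
      fix m :: nat
      show "mpoly_vars 0 \<subseteq> cusp_vars m"
        by (simp add: mpoly_vars_def)
    qed (use False N n in \<open>auto simp: cusp_cover_def\<close>)
  next
    case True
    then obtain a0 f0 A0 B0 where "cusp_cover N ?n a0 f0 A0 B0"
      by blast
    then interpret src: cusp_cover N ?n a0 f0 A0 B0 .
    obtain \<Phi>0 where \<Phi>0: "cusp_log N f0 A0 \<Phi>0" "(\<Phi>0 has_field_derivative - (B0 / A0)) (at 0)" "A0 \<noteq> 0"
      by (rule src.ex_cusp_log) blast
    define P where "P = fps_expansion \<Phi>0 0"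
    have P: "\<Phi>0 has_fps_expansion P"
      unfolding P_def using \<Phi>0(1)
      by (intro analytic_at_imp_has_fps_expansion_0) (simp add: cusp_log_def)
    \<comment> \<open>These are the coefficients of \<open>\<Phi>\<close> for any covering with
      \<open>B / A = x\<close>.\<close>
    define \<phi> where "\<phi> x = fps_nth (change_coord P (B0 / A0 - x))" for x
    have \<phi>_poly: "\<exists>p. \<forall>x. \<phi> x k = poly p x" for k
    proof -
      obtain p where p: "\<forall>c. fps_nth (change_coord P c) k = poly p c"
        using fps_nth_change_coord_poly by blast
      show ?thesis
        by (intro exI[of _ "pcompose p [:B0 / A0, - 1:]"]) (simp add: \<phi>_def p poly_pcompose)
    qed
    have "\<forall>m. \<exists>p. mpoly_vars p \<subseteq> cusp_vars m \<and>
        (\<forall>A B z. mpoly_eval (cusp_value A B m z) p =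
          cusp_coeff (\<phi> (B / A)) (z / A) (ln (norm (z / A))) m)"
      by (intro allI cusp_poly_imp_mpoly cusp_poly_cusp_coeff \<phi>_poly)
    \<comment> \<open>\<open>R\<close> is chosen from \<open>N\<close> and the reference covering
      alone, before \<open>f\<close>, \<open>A\<close> and \<open>B\<close> are given.\<close>
    from choice[OF this] obtain R where
      R: "\<forall>m. mpoly_vars (R m) \<subseteq> cusp_vars m \<and>
        (\<forall>A B z. mpoly_eval (cusp_value A B m z) (R m) =
          cusp_coeff (\<phi> (B / A)) (z / A) (ln (norm (z / A))) m)" ..
    have R_term: "cusp_term R A B m z = cusp_coeff (\<phi> (B / A)) (z / A) (ln (norm (z / A))) m" for A B m z
      using R by (simp add: cusp_term_def)
    show ?thesis
    proof (intro exI[of _ R] conjI allI impI)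
      show "mpoly_vars (R m) \<subseteq> cusp_vars m" for m
        using R by blast
    next
      fix a f A B
      assume a: "a 1 = Aff 0" "covering_space upper_half_plane f (UNIV - a ` {1..?n})"
        "cp1_holomorphic_on f upper_half_plane" "deck_group f = principal_congruence_group N"
        "has_q_expansion N f A B"
      interpret tgt: cusp_cover N ?n a f A B
        using a N n by unfold_locales
      obtain \<Phi> where \<Phi>: "cusp_log N f A \<Phi>" "(\<Phi> has_field_derivative - (B / A)) (at 0)" "A \<noteq> 0"
        by (rule tgt.ex_cusp_log) blast
      interpret pair: cusp_cover_pair N ?n a0 f0 A0 B0 ?n a f A B \<Phi>0 \<Phi>
        using \<Phi>0 \<Phi> by unfold_locales
      define F where "F = change_coord P (B0 / A0 - B / A)"
      have F: "\<Phi> has_fps_expansion F"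
        unfolding F_def by (rule pair.cusp_log_has_fps_expansion[OF \<Phi>0(2) \<Phi>(2) P])
      then have "0 < fps_conv_radius F"
        by (simp add: has_fps_expansion_def)
      then obtain K where K: "0 < K" "\<And>k. 0 < k \<Longrightarrow> norm (of_nat k * fps_nth F k) \<le> K ^ k"
        by (rule fps_conv_radius_pos_imp_bound) blast
      have term_eq: "cusp_term R A B m z = cusp_coeff (fps_nth F) (z / A) (ln (norm (z / A))) m" for m z
        by (simp add: R_term \<phi>_def F_def)
      note density = tgt.eventually_density_expansion[OF \<Phi>(1,3,2) F K]
      show "\<forall>\<^sub>F z in at 0.
          summable (\<lambda>k. cusp_term R A B (k + 2) z) \<and>
          induced_density f z =
            1 / (norm z * \<bar>ln (norm (z / A))\<bar>) *
            norm (1 - (B / A * (z / A)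
                       - of_real (Re (B / A * (z / A)) / ln (norm (z / A))))
                    + suminf (\<lambda>k. cusp_term R A B (k + 2) z))"
        using eventually_compose_filterlim[OF density filterlim_divide_at_0[OF \<Phi>(3)]] \<Phi>(3)
        unfolding term_eq by simp
      show "(\<lambda>z. suminf (\<lambda>k. cusp_term R A B (k + (M + 1)) z)) \<in> O[at 0](\<lambda>z. z ^ (M + 1))" for M
        unfolding term_eq by (rule tgt.suminf_tail_bigo[OF \<Phi>(1,3,2) F K])
    qed
  qed
qed

end
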